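(* Let $T$ and $T'$ be densely defined simple symmetric operators in Pontryagin spaces $\mathfrak H$ and $\mathfrak H'$, respectively, both having the same equal defect numbers. Let $\Pi_\Gamma=(\mathfrak L,\Gamma_0,\Gamma_1)$ and $\Pi_{\Gamma'}=(\mathfrak L,\Gamma'_0,\Gamma'_1)$ be boundary triples for $T^+$ and $T'^{+}$ (with the same Hilbert space $\mathfrak L$), with Weyl families $M_\Gamma$ and $M_{\Gamma'}$. If $M_\Gamma(z)=M_{\Gamma'}(z)$ for all $z\in\mathbb C\setminus\mathbb R$, then $\Pi_\Gamma$ and $\Pi_{\Gamma'}$ are similar, i.e. there is a standard unitary operator $U\colon\mathfrak H\to\mathfrak H'$ such that $\Gamma'=\Gamma\widetilde U^{-1}$ with $\widetilde U=\begin{pmatrix}U&0\\0&U\end{pmatrix}\colon\mathfrak H^2\to\mathfrak H'^2$. In particular, for every linear relation $\Theta$ in $\mathfrak L$ the canonical extensions $\Gamma^{-1}(\Theta)$ of $T$ and $\Gamma'^{-1}(\Theta)$ of $T'$ are related by $\Gamma'^{-1}(\Theta)=U\,\Gamma^{-1}(\Theta)\,U^{-1}$.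
   Context: All spaces are complex; relations and operators are linear. A relation from $X$ to $Y$ is a linear subset of $X\times Y$; operators are identified with their graphs; inverses, products and images $R(L)=\{y: (x,y)\in R,\ x\in L\}$ are taken in the sense of relations. A Krein space $(\mathfrak H,[\cdot,\cdot])$ with fundamental symmetry $J$ has inner product conjugate-linear in the first factor, and $(\mathfrak H,[\cdot,J\cdot])$ is a Hilbert space, which defines the topology; a Pontryagin space is a Krein space with finite rank of indefiniteness. For a relation $T$ in $\mathfrak H$ (a linear subset of $\mathfrak H^2$), $T^+=\{(g,g')\in\mathfrak H^2: [f,g']=[f',g]\ \forall (f,f')\in T\}$; $T$ is symmetric if $T\subseteq T^+$. The eigenspace is $\mathfrak N_z(T)=\ker(T-zI)$. Equal defect numbers: a closed symmetric $T$ has equal defect numbers $(d,d)$, $d\le\infty$, if $\dim\ker(JT^+-iI)=\dim\ker(JT^++iI)=d$, where $JT^+=\{(f,Jf'):(f,f')\in T^+\}$ is the Hilbert space adjoint of $JT$ in $(\mathfrak H,[\cdot,J\cdot])$. Simple: a closed symmetric relation $T$ in a Pontryagin space is a simple symmetric operator if it has no non-real eigenvalues and the closed linear span of $\{\mathfrak N_z(T^+): z\in\mathbb C\setminus\mathbb R\}$ is $\mathfrak H$ (then $T$ is automatically an operator). Boundary triple: $(\mathfrak L,\Gamma_0,\Gamma_1)$, with $(\mathfrak L,\langle\cdot,\cdot\rangle)$ a Hilbert space, is a boundary triple for $T^+$ if $\Gamma=(\Gamma_0,\Gamma_1)\colon T^+\to\mathfrak L^2$ is linear, surjective, and $[f,g']-[f',g]=\langle\Gamma_0\hat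 f,\Gamma_1\hat g\rangle-\langle\Gamma_1\hat f,\Gamma_0\hat g\rangle$ for all $\hat f=(f,f'),\hat g=(g,g')\in T^+$. Its Weyl family is $M_\Gamma(z)=\Gamma(zI)=\Gamma(zI\cap T^+)$, $z\in\mathbb C$, a relation in $\mathfrak L$, where $zI=\{(f,zf):f\in\mathfrak H\}$. A canonical extension of $T$ is a relation $\widetilde T$ with $T\subseteq\widetilde T\subseteq T^+$. A standard unitary operator $U\colon\mathfrak H\to\mathfrak H'$ between Krein spaces is a bounded everywhere defined bijective operator with $[Uf,Ug]'=[f,g]$ for all $f,g$. *)

theory Defs
  imports "HOL-Analysis.Analysis" "HOL-Library.Extended_Nat"
begin

section \<open>Complex Hilbert spaces\<close>

text \<open>
  A complex Hilbert space is a real Hilbert space with a compatible complex structure; norm and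
  topology are those of the real one. The inner product is conjugate-linear in the first argument.
\<close>

class complex_hilbert = real_inner + complete_space +
  fixes scaleC :: "complex \<Rightarrow> 'a \<Rightarrow> 'a"  (infixr \<open>*\<^sub>C\<close> 75)
    and cinner :: "'a \<Rightarrow> 'a \<Rightarrow> complex"
  assumes scaleC_add_right: "c *\<^sub>C (x + y) = c *\<^sub>C x + c *\<^sub>C y"
    and scaleC_add_left: "(c + d) *\<^sub>C x = c *\<^sub>C x + d *\<^sub>C x"
    and scaleC_scaleC: "c *\<^sub>C d *\<^sub>C x = (c * d) *\<^sub>C x"
    and scaleC_of_real: "complex_of_real r *\<^sub>C x = r *\<^sub>R x"
    and cinner_commute: "cinner y x = cnj (cinner x y)"
    and cinner_add_right: "cinner x (y + z) = cinner x y + cinner x z"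
    and cinner_scaleC_right: "cinner x (c *\<^sub>C y) = c * cinner x y"
    and Re_cinner: "Re (cinner x y) = inner x y"

global_interpretation complex_vector:
  vector_space "scaleC :: complex \<Rightarrow> 'a \<Rightarrow> 'a::complex_hilbert"
proof
  show "1 *\<^sub>C x = x" for x :: 'a
    using scaleC_of_real[of 1 x] by simp
qed (simp_all add: scaleC_add_right scaleC_add_left scaleC_scaleC)

instantiation prod :: (complex_hilbert, complex_hilbert) complex_hilbert
begin

definition "c *\<^sub>C x = (c *\<^sub>C fst x, c *\<^sub>C snd x)"

definition "cinner x y = cinner (fst x) (fst y) + cinner (snd x) (snd y)"

instance
proof
  show "cinner y x = cnj (cinner x y)" for x y :: "'a \<times> 'b"
    using cinner_commute[of "fst y" "fst x"] cinner_commute[of "snd y" "snd x"]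
    by (simp add: cinner_prod_def)
qed (auto simp: scaleC_prod_def cinner_prod_def scaleC_add_right scaleC_add_left scaleC_scaleC
    scaleC_of_real cinner_add_right cinner_scaleC_right Re_cinner inner_prod_def
    algebra_simps prod_eq_iff)

end

text \<open>Dimension with a single infinite value, as opposed to \<^const>\<open>complex_vector.dim\<close>, which is
  \<open>0\<close> on infinite-dimensional subspaces.\<close>

definition cdim :: "'a::complex_hilbert set \<Rightarrow> enat" where
  "cdim S = (if \<exists>B. finite B \<and> S \<subseteq> complex_vector.span B
             then enat (complex_vector.dim S) else \<infinity>)"


section \<open>Krein and Pontryagin spaces\<close>

text \<open>The Hilbert space inner product \<open>[\<cdot>, J\<cdot>]\<close> is \<^const>\<open>cinner\<close>, so the topology of the type is
  the one of the Krein space.\<close>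

locale krein_space =
  fixes J :: "'h::complex_hilbert \<Rightarrow> 'h"
    and ip :: "'h \<Rightarrow> 'h \<Rightarrow> complex"
  assumes ip_commute: "ip y x = cnj (ip x y)"
    and ip_add_right: "ip x (y + z) = ip x y + ip x z"
    and ip_scaleC_right: "ip x (c *\<^sub>C y) = c * ip x y"
    and J_add: "J (x + y) = J x + J y"
    and J_scaleC: "J (c *\<^sub>C x) = c *\<^sub>C J x"
    and J_J: "J (J x) = x"
    and ip_J_J: "ip (J x) (J y) = ip x y"
    and ip_J: "ip x (J y) = cinner x y"

text \<open>The rank of indefiniteness is the smaller of the dimensions of the two components of the
  fundamental decomposition \<open>ker (J - I) + ker (J + I)\<close>.\<close>

locale pontryagin_space = krein_space +
  assumes finite_rank: "min (cdim {x. J x = x}) (cdim {x. J x = - x}) < \<infinity>"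

definition standard_unitary ::
  "('h::complex_hilbert \<Rightarrow> 'h \<Rightarrow> complex) \<Rightarrow> ('k::complex_hilbert \<Rightarrow> 'k \<Rightarrow> complex)
    \<Rightarrow> ('h \<Rightarrow> 'k) \<Rightarrow> bool" where
  "standard_unitary ip ip' U \<longleftrightarrow>
     bounded_linear U \<and> (\<forall>c x. U (c *\<^sub>C x) = c *\<^sub>C U x) \<and> bij U
     \<and> (\<forall>f g. ip' (U f) (U g) = ip f g)"


section \<open>Linear relations\<close>

text \<open>Isabelle's relational composition \<open>R O S\<close> is the operator-theoretic product \<open>S R\<close>.\<close>

abbreviation linear_relation :: "('a::complex_hilbert \<times> 'b::complex_hilbert) set \<Rightarrow> bool" where
  "linear_relation R \<equiv> complex_vector.subspace R"

definition op_graph :: "'a set \<Rightarrow> ('a \<Rightarrow> 'b) \<Rightarrow> ('a \<times> 'b) set" where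
  "op_graph D A = {(x, A x) | x. x \<in> D}"

definition scalar_rel :: "complex \<Rightarrow> ('h::complex_hilbert \<times> 'h) set" where
  "scalar_rel z = op_graph UNIV (\<lambda>f. z *\<^sub>C f)"

definition eigenspace :: "complex \<Rightarrow> ('h::complex_hilbert \<times> 'h) set \<Rightarrow> 'h set" where
  "eigenspace z T = {f. (f, z *\<^sub>C f) \<in> T}"

definition adjoint_rel :: "('h \<Rightarrow> 'h \<Rightarrow> complex) \<Rightarrow> ('h \<times> 'h) set \<Rightarrow> ('h \<times> 'h) set" where
  "adjoint_rel ip T = {(g, g'). \<forall>(f, f') \<in> T. ip f g' = ip f' g}"

definition closed_symmetric ::
  "('h::complex_hilbert \<Rightarrow> 'h \<Rightarrow> complex) \<Rightarrow> ('h \<times> 'h) set \<Rightarrow> bool" where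
  "closed_symmetric ip T \<longleftrightarrow> linear_relation T \<and> closed T \<and> T \<subseteq> adjoint_rel ip T"

definition densely_defined :: "('h::complex_hilbert \<times> 'h) set \<Rightarrow> bool" where
  "densely_defined T \<longleftrightarrow> closure (Domain T) = UNIV"

definition simple_symmetric ::
  "('h::complex_hilbert \<Rightarrow> 'h \<Rightarrow> complex) \<Rightarrow> ('h \<times> 'h) set \<Rightarrow> bool" where
  "simple_symmetric ip T \<longleftrightarrow>
     closed_symmetric ip T
     \<and> (\<forall>z. z \<notin> \<real> \<longrightarrow> eigenspace z T = {0})
     \<and> closure (complex_vector.span (\<Union>z \<in> - \<real>. eigenspace z (adjoint_rel ip T))) = UNIV"

definition equal_defect_numbers ::
  "('h::complex_hilbert \<Rightarrow> 'h) \<Rightarrow> ('h \<Rightarrow> 'h \<Rightarrow> complex) \<Rightarrow> ('h \<times> 'h) set \<Rightarrow> enat \<Rightarrow> bool" where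
  "equal_defect_numbers J ip T d \<longleftrightarrow>
     cdim (eigenspace \<i> (adjoint_rel ip T O op_graph UNIV J)) = d
     \<and> cdim (eigenspace (- \<i>) (adjoint_rel ip T O op_graph UNIV J)) = d"

definition canonical_extension ::
  "('h::complex_hilbert \<Rightarrow> 'h \<Rightarrow> complex) \<Rightarrow> ('h \<times> 'h) set \<Rightarrow> ('h \<times> 'h) set \<Rightarrow> bool" where
  "canonical_extension ip T A \<longleftrightarrow> linear_relation A \<and> T \<subseteq> A \<and> A \<subseteq> adjoint_rel ip T"


section \<open>Boundary triples\<close>

text \<open>The boundary maps are total functions of which only the values on \<open>T\<^sup>+\<close> matter; the operator
  \<open>\<Gamma> = (\<Gamma>\<^sub>0, \<Gamma>\<^sub>1)\<close> with domain \<open>T\<^sup>+\<close> is the relation \<open>boundary_map\<close>.\<close>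

definition boundary_map ::
  "('h::complex_hilbert \<Rightarrow> 'h \<Rightarrow> complex) \<Rightarrow> ('h \<times> 'h) set
    \<Rightarrow> ('h \<times> 'h \<Rightarrow> 'l) \<Rightarrow> ('h \<times> 'h \<Rightarrow> 'l) \<Rightarrow> (('h \<times> 'h) \<times> ('l \<times> 'l)) set" where
  "boundary_map ip T \<Gamma>0 \<Gamma>1 = op_graph (adjoint_rel ip T) (\<lambda>f. (\<Gamma>0 f, \<Gamma>1 f))"

definition boundary_triple ::
  "('h::complex_hilbert \<Rightarrow> 'h \<Rightarrow> complex) \<Rightarrow> ('h \<times> 'h) set
    \<Rightarrow> ('h \<times> 'h \<Rightarrow> 'l::complex_hilbert) \<Rightarrow> ('h \<times> 'h \<Rightarrow> 'l) \<Rightarrow> bool" where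
  "boundary_triple ip T \<Gamma>0 \<Gamma>1 \<longleftrightarrow>
     linear_relation (boundary_map ip T \<Gamma>0 \<Gamma>1)
     \<and> Range (boundary_map ip T \<Gamma>0 \<Gamma>1) = UNIV
     \<and> (\<forall>(f, f') \<in> adjoint_rel ip T. \<forall>(g, g') \<in> adjoint_rel ip T.
          ip f g' - ip f' g
            = cinner (\<Gamma>0 (f, f')) (\<Gamma>1 (g, g')) - cinner (\<Gamma>1 (f, f')) (\<Gamma>0 (g, g')))"

definition weyl_family ::
  "('h::complex_hilbert \<Rightarrow> 'h \<Rightarrow> complex) \<Rightarrow> ('h \<times> 'h) set
    \<Rightarrow> ('h \<times> 'h \<Rightarrow> 'l) \<Rightarrow> ('h \<times> 'h \<Rightarrow> 'l) \<Rightarrow> complex \<Rightarrow> ('l \<times> 'l) set" where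
  "weyl_family ip T \<Gamma>0 \<Gamma>1 z = boundary_map ip T \<Gamma>0 \<Gamma>1 `` scalar_rel z"

definition similar_via ::
  "('h::complex_hilbert \<Rightarrow> 'h \<Rightarrow> complex) \<Rightarrow> ('k::complex_hilbert \<Rightarrow> 'k \<Rightarrow> complex)
    \<Rightarrow> ('h \<Rightarrow> 'k) \<Rightarrow> (('h \<times> 'h) \<times> ('l \<times> 'l)) set \<Rightarrow> (('k \<times> 'k) \<times> ('l \<times> 'l)) set \<Rightarrow> bool" where
  "similar_via ip ip' U \<Gamma> \<Gamma>' \<longleftrightarrow>
     standard_unitary ip ip' U \<and> \<Gamma>' = (op_graph UNIV (map_prod U U))\<inverse> O \<Gamma>"

end

theory Submission
  imports Defs
begin

text \<open>
  The idea is to define \<open>U\<close> on eigenvectors of \<open>T\<^sup>+\<close> by equality of boundary values. Since the Weyl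
  families agree, every \<open>f \<in> \<NN>\<^sub>z(T\<^sup>+)\<close> has a partner \<open>g \<in> \<NN>\<^sub>z(T'\<^sup>+)\<close> with the same boundary values, and
  vice versa. Green's identity \<open>(w - z\<^sup>*) [f, h] = \<langle>\<Gamma>\<^sub>0 f, \<Gamma>\<^sub>1 h\<rangle> - \<langle>\<Gamma>\<^sub>1 f, \<Gamma>\<^sub>0 h\<rangle>\<close> for eigenvectors \<open>f\<close>, \<open>h\<close>
  to \<open>z\<close>, \<open>w\<close> shows that passing to partners preserves the indefinite inner product, except that it
  says nothing for \<open>w = z\<^sup>*\<close>. The exception is avoided by admitting only eigenvalues from a set \<open>S\<close>
  that is dense in the non-real numbers but contains no conjugate pair
  (\<open>dense_set_without_conjugate_pairs\<close>).

  Nothing is lost by the restriction to \<open>S\<close>, because the eigenspaces depend continuously on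
  the eigenvalue (\<open>orthogonal_eigenspace_limit\<close>): \<open>\<NN>\<^sub>w(T\<^sup>+)\<close> is the orthogonal complement of the range
  of \<open>T - w\<^sup>*\<close>, and \<open>T - w\<^sup>*\<close> is bounded below (\<open>shift_bounded_below\<close>), which makes the range closed
  and stable under small changes of \<open>w\<close>. So the eigenspaces for \<open>S\<close> still span dense subspaces,
  and the pairs of partners span an isometric linear relation with dense domain and dense range.

  In Pontryagin spaces such a relation is automatically bounded in both directions
  (\<open>isometric_relation_bounded\<close>), hence extends to a standard unitary operator \<open>U\<close>. Both this and the
  lower bound for \<open>T - w\<^sup>*\<close> rest on the fact that finitely many functionals together with the form
  \<open>[x, x]\<close> control the norm (\<open>norm_square_le_ip\<close>).

  Finally, \<open>T\<close> can be recovered from the eigenvectors: \<open>(u, u') \<in> T\<close> if and only if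
  \<open>[u, v h] = [u', h]\<close> for all \<open>h \<in> \<NN>\<^sub>v(T\<^sup>+)\<close>, \<open>v \<in> S\<close> (\<open>in_T_if_annihilates_eigenspaces\<close>). So \<open>U\<close> carries
  \<open>T\<close> to \<open>T'\<close> and \<open>T\<^sup>+\<close> to \<open>T'\<^sup>+\<close>. An element of \<open>T\<^sup>+\<close>, transported by \<open>U\<close>, and an element of \<open>T'\<^sup>+\<close>
  with the same boundary values differ by an element of \<open>T'\<close>, again by this criterion and Green's
  identity; and boundary maps vanish on \<open>T'\<close>. Therefore \<open>U\<close> intertwines the boundary maps
  everywhere.
\<close>

section \<open>The inner product of a complex Hilbert space\<close>

lemma cinner_add_left: "cinner (x + y) z = cinner x z + cinner y z"
  by (metis cinner_add_right cinner_commute complex_cnj_add)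

lemma cinner_scaleC_left: "cinner (c *\<^sub>C x) y = cnj c * cinner x y"
  by (metis cinner_scaleC_right cinner_commute complex_cnj_mult)

lemma cinner_self: "cinner x x = of_real ((norm x)\<^sup>2)"
proof -
  have "Im (cinner x x) = 0"
    using arg_cong[OF cinner_commute[of x x], of Im] by simp
  then show ?thesis
    by (simp add: complex_eq_iff Re_cinner dot_square_norm)
qed

lemma norm_scaleC: "norm (c *\<^sub>C x) = cmod c * norm (x :: 'a::complex_hilbert)"
proof -
  have "complex_of_real ((norm (c *\<^sub>C x))\<^sup>2) = of_real ((cmod c * norm x)\<^sup>2)"
    unfolding cinner_self[symmetric]
    by (simp add: cinner_scaleC_left cinner_scaleC_right cinner_self[of x] complex_norm_square
        power_mult_distrib mult.commute mult.left_commute del: of_real_power)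
  then have "(norm (c *\<^sub>C x))\<^sup>2 = (cmod c * norm x)\<^sup>2"
    using of_real_eq_iff by blast
  then show ?thesis
    by simp
qed

lemma cmod_cinner_le: "cmod (cinner x y) \<le> norm x * norm y"
proof -
  define c where "c = cnj (sgn (cinner x y))"
  have c: "c * cinner x y = of_real (cmod (cinner x y))"
    unfolding c_def by (simp add: sgn_eq complex_norm_square[symmetric] power2_eq_square mult.commute)
  have c1: "cmod c \<le> 1"
    by (simp add: c_def norm_sgn)
  have "cmod (cinner x y) = inner x (c *\<^sub>C y)"
    unfolding Re_cinner[symmetric] cinner_scaleC_right c by simp
  also have "\<dots> \<le> norm x * norm (c *\<^sub>C y)"
    by (rule norm_cauchy_schwarz)
  also have "\<dots> \<le> norm x * norm y"
    using c1 by (intro mult_left_mono) (auto simp: norm_scaleC mult_left_le_one_le)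
  finally show ?thesis .
qed

interpretation scaleC: bounded_bilinear "scaleC :: complex \<Rightarrow> 'a \<Rightarrow> 'a::complex_hilbert"
proof
  show "(r *\<^sub>R c) *\<^sub>C x = r *\<^sub>R (c *\<^sub>C x)" "c *\<^sub>C (r *\<^sub>R x) = r *\<^sub>R (c *\<^sub>C x)" for r c and x :: 'a
    by (simp_all add: scaleC_of_real[symmetric] scaleC_scaleC scaleR_conv_of_real mult.commute)
  show "\<exists>K. \<forall>c x. norm (c *\<^sub>C (x::'a)) \<le> norm c * norm x * K"
    by (rule exI[of _ 1]) (simp add: norm_scaleC)
qed (simp_all add: scaleC_add_left scaleC_add_right)

interpretation cinner: bounded_bilinear "cinner :: 'a::complex_hilbert \<Rightarrow> 'a \<Rightarrow> complex"
proof
  show "cinner (r *\<^sub>R x) y = r *\<^sub>R cinner x y" "cinner x (r *\<^sub>R y) = r *\<^sub>R cinner x y"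
    for r and x y :: 'a
    by (simp_all add: scaleC_of_real[symmetric] cinner_scaleC_left cinner_scaleC_right
        scaleR_conv_of_real)
  show "\<exists>K. \<forall>x y. norm (cinner x (y::'a)) \<le> norm x * norm y * K"
    by (rule exI[of _ 1]) (simp add: cmod_cinner_le)
qed (simp_all add: cinner_add_left cinner_add_right)

lemma subspace_of_complex_subspace: "complex_vector.subspace M \<Longrightarrow> subspace M"
  unfolding complex_vector.subspace_def subspace_def by (metis scaleC_of_real)

lemma complex_subspace_closure:
  assumes "complex_vector.subspace M"
  shows "complex_vector.subspace (closure M)"
proof (rule complex_vector.subspaceI)
  show "0 \<in> closure M"
    using assms closure_subset complex_vector.subspace_0 by blast
next
  fix x y assume "x \<in> closure M" "y \<in> closure M"
  then obtain X Y where "\<And>n::nat. X n \<in> M" "X \<longlonglongrightarrow> x" "\<And>n::nat. Y n \<in> M" "Y \<longlonglongrightarrow> y"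
    unfolding closure_sequential by blast
  then show "x + y \<in> closure M"
    unfolding closure_sequential using assms
    by (intro exI[of _ "\<lambda>n. X n + Y n"]) (auto intro: tendsto_add complex_vector.subspace_add)
next
  fix c x assume "x \<in> closure M"
  then obtain X where "\<And>n::nat. X n \<in> M" "X \<longlonglongrightarrow> x"
    unfolding closure_sequential by blast
  then show "c *\<^sub>C x \<in> closure M"
    unfolding closure_sequential using assms
    by (intro exI[of _ "\<lambda>n. c *\<^sub>C X n"])
      (auto intro: scaleC.tendsto complex_vector.subspace_scale)
qed

lemma Cauchy_if_dist_square_le:
  fixes X :: "nat \<Rightarrow> 'a::metric_space"
  assumes "\<And>m n. (dist (X m) (X n))\<^sup>2 \<le> b m + b n" and "b \<longlonglongrightarrow> (0::real)"
  shows "Cauchy X"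
proof (rule metric_CauchyI)
  fix e :: real assume "e > 0"
  then have "\<forall>\<^sub>F n in sequentially. b n < e\<^sup>2 / 2"
    using assms(2) by (intro order_tendstoD) auto
  then obtain N where N: "\<And>n. n \<ge> N \<Longrightarrow> b n < e\<^sup>2 / 2"
    unfolding eventually_sequentially by blast
  have "dist (X m) (X n) < e" if "m \<ge> N" "n \<ge> N" for m n
  proof (rule power2_less_imp_less)
    show "(dist (X m) (X n))\<^sup>2 < e\<^sup>2"
      using assms(1)[of m n] N[OF that(1)] N[OF that(2)] by linarith
  qed (use \<open>e > 0\<close> in simp)
  then show "\<exists>N. \<forall>m\<ge>N. \<forall>n\<ge>N. dist (X m) (X n) < e"
    by blast
qed

section \<open>Orthogonality and closed subspaces\<close>

text \<open>
  The vector \<open>g\<close> is the difference of \<open>h\<close> and its best approximation in \<open>M\<close>. A minimizing sequence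
  for the distance converges because, by the parallelogram law, the distance of two of its members
  is controlled by how nearly they attain the infimum.
\<close>

lemma real_orthogonal_to_closed_subspace:
  fixes M :: "'a::{real_inner,complete_space} set"
  assumes "subspace M" and "closed M" and "h \<notin> M"
  shows "\<exists>g. (\<forall>m\<in>M. inner m g = 0) \<and> inner h g \<noteq> 0"
proof -
  define d where "d = infdist h M"
  have "M \<noteq> {}"
    using assms(1) subspace_0 by blast
  have d_le: "d \<le> norm (h - m)" if "m \<in> M" for m
    using infdist_le[OF that, of h] by (simp add: d_def dist_norm)
  have d0: "d \<ge> 0"
    by (simp add: d_def infdist_nonneg)
  have "\<exists>m\<in>M. (norm (h - m))\<^sup>2 < d\<^sup>2 + 1 / Suc n" for n
  proof -
    have "d < sqrt (d\<^sup>2 + 1 / Suc n)"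
      using d0 by (intro real_less_rsqrt) simp
    then obtain m where "m \<in> M" "dist h m < sqrt (d\<^sup>2 + 1 / Suc n)"
      using \<open>M \<noteq> {}\<close> unfolding d_def infdist_notempty[OF \<open>M \<noteq> {}\<close>]
      by (subst (asm) cINF_less_iff) auto
    moreover from this have "(norm (h - m))\<^sup>2 < (sqrt (d\<^sup>2 + 1 / Suc n))\<^sup>2"
      by (intro power_strict_mono) (auto simp: dist_norm)
    ultimately show ?thesis
      by (intro bexI[of _ m]) auto
  qed
  then obtain X where X: "\<And>n. X n \<in> M" "\<And>n. (norm (h - X n))\<^sup>2 < d\<^sup>2 + 1 / Suc n"
    by metis
  have "(dist (X m) (X n))\<^sup>2 \<le> 2 / Suc m + 2 / Suc n" for m n
  proof -
    have "(1/2) *\<^sub>R (X m + X n) \<in> M"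
      using X(1) assms(1) by (intro subspace_scale subspace_add)
    then have "d \<le> norm (h - (1/2) *\<^sub>R (X m + X n))"
      by (rule d_le)
    then have "d\<^sup>2 \<le> (norm (h - (1/2) *\<^sub>R (X m + X n)))\<^sup>2"
      using d0 by (intro power_mono)
    moreover have "(dist (X m) (X n))\<^sup>2 + 4 * (norm (h - (1/2) *\<^sub>R (X m + X n)))\<^sup>2
        = 2 * (norm (h - X m))\<^sup>2 + 2 * (norm (h - X n))\<^sup>2"
      by (simp add: dist_norm power2_norm_eq_inner inner_add_left inner_add_right inner_diff_left
          inner_diff_right inner_commute algebra_simps)
    ultimately show ?thesis
      using X(2)[of m] X(2)[of n] by simp
  qed
  moreover have "(\<lambda>n. 2 / real (Suc n)) \<longlonglongrightarrow> 0"
    using tendsto_mult_right_zero[OF LIMSEQ_inverse_real_of_nat, of 2] by (simp add: divide_inverse)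
  ultimately have "Cauchy X"
    by (rule Cauchy_if_dist_square_le)
  then obtain p where p: "X \<longlonglongrightarrow> p"
    using Cauchy_convergent_iff convergent_def by blast
  have "p \<in> M"
    using assms(2) X(1) p closed_sequentially by blast
  define g where "g = h - p"
  have "(\<lambda>n. (norm (h - X n))\<^sup>2) \<longlonglongrightarrow> (norm g)\<^sup>2"
    unfolding g_def by (intro tendsto_intros p)
  moreover have "(\<lambda>n. d\<^sup>2 + 1 / real (Suc n)) \<longlonglongrightarrow> d\<^sup>2 + 0"
    using LIMSEQ_inverse_real_of_nat by (intro tendsto_intros) (simp add: divide_inverse)
  ultimately have "(norm g)\<^sup>2 \<le> d\<^sup>2"
    using X(2) by (intro LIMSEQ_le) (auto intro: less_imp_le)
  have orth: "inner m g = 0" if "m \<in> M" for m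
  proof (rule ccontr)
    assume m: "inner m g \<noteq> 0"
    define t where "t = inner m g / inner m m"
    have "m \<noteq> 0"
      using m by auto
    have "p + t *\<^sub>R m \<in> M"
      using assms(1) that \<open>p \<in> M\<close> by (intro subspace_scale subspace_add)
    then have "d\<^sup>2 \<le> (norm (g - t *\<^sub>R m))\<^sup>2"
      using d_le[of "p + t *\<^sub>R m"] d0 by (intro power_mono) (simp_all add: g_def algebra_simps)
    also have "\<dots> = (norm g)\<^sup>2 - 2 * t * inner m g + t\<^sup>2 * inner m m"
      by (simp add: power2_norm_eq_inner inner_diff_left inner_diff_right inner_commute[of m g]
          power2_eq_square[of t] algebra_simps)
    also have "\<dots> = (norm g)\<^sup>2 - (inner m g)\<^sup>2 / inner m m"
      using \<open>m \<noteq> 0\<close> by (simp add: t_def power2_eq_square field_simps)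
    also have "\<dots> < (norm g)\<^sup>2"
      using m \<open>m \<noteq> 0\<close> by simp
    finally show False
      using \<open>(norm g)\<^sup>2 \<le> d\<^sup>2\<close> by simp
  qed
  have "inner h g = inner p g + inner g g"
    by (simp add: g_def inner_diff_left)
  also have "\<dots> \<noteq> 0"
    using orth[OF \<open>p \<in> M\<close>] assms(3) \<open>p \<in> M\<close> by (auto simp: g_def)
  finally show ?thesis
    using orth by blast
qed

lemma orthogonal_to_closed_subspace:
  assumes "complex_vector.subspace M" and "closed M" and "h \<notin> M"
  shows "\<exists>g. (\<forall>m\<in>M. cinner m g = 0) \<and> cinner h g \<noteq> 0"
proof -
  obtain g where g: "\<And>m. m \<in> M \<Longrightarrow> inner m g = 0" "inner h g \<noteq> 0"
    using real_orthogonal_to_closed_subspace[OF subspace_of_complex_subspace] assms by blast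
  have "cinner m g = 0" if "m \<in> M" for m
  proof -
    have "\<i> *\<^sub>C m \<in> M"
      using assms(1) that by (rule complex_vector.subspace_scale)
    then have "Re (cinner (\<i> *\<^sub>C m) g) = 0"
      using g(1) by (simp add: Re_cinner)
    moreover have "Re (cinner m g) = 0"
      using g(1) that by (simp add: Re_cinner)
    ultimately show ?thesis
      by (simp add: cinner_scaleC_left complex_eq_iff)
  qed
  moreover have "cinner h g \<noteq> 0"
    using g(2) Re_cinner[of h g] by auto
  ultimately show ?thesis
    by blast
qed

text \<open>Gram-Schmidt orthonormalization, in the form of an expansion formula.\<close>

lemma finite_orthonormal_expansion:
  assumes "finite B"
  shows "\<exists>E. finite E \<and> E \<subseteq> complex_vector.span B
    \<and> (\<forall>x\<in>complex_vector.span B. x = (\<Sum>e\<in>E. cinner e x *\<^sub>C e))"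
  using assms
proof induction
  case empty
  show ?case
    by (rule exI[of _ "{}"]) simp
next
  case (insert b B)
  then obtain E where E: "finite E" "E \<subseteq> complex_vector.span B"
    and expand: "\<And>x. x \<in> complex_vector.span B \<Longrightarrow> x = (\<Sum>e\<in>E. cinner e x *\<^sub>C e)"
    by blast
  have mono: "complex_vector.span B \<subseteq> complex_vector.span (insert b B)"
    by (intro complex_vector.span_mono) auto
  define b' where "b' = (\<Sum>e\<in>E. cinner e b *\<^sub>C e)"
  define p where "p = b - b'"
  have b': "b' \<in> complex_vector.span B"
    unfolding b'_def using E(2) by (intro complex_vector.span_sum complex_vector.span_scale) auto
  have orth: "cinner y p = 0" if "y \<in> complex_vector.span B" for y
  proof -
    have "cinner y b = (\<Sum>e\<in>E. cnj (cinner e y) * cinner e b)"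
      by (subst expand[OF that]) (simp add: cinner.sum_left cinner_scaleC_left)
    also have "\<dots> = cinner y b'"
      unfolding b'_def
      by (simp add: cinner.sum_right cinner_scaleC_right cinner_commute[of _ y] mult.commute)
    finally show ?thesis
      by (simp add: p_def cinner.diff_right)
  qed
  show ?case
  proof (cases "p = 0")
    case True
    then have "complex_vector.span (insert b B) = complex_vector.span B"
      using b' by (intro complex_vector.span_redundant) (simp add: p_def)
    then show ?thesis
      using E expand by auto
  next
    case False
    define q where "q = complex_of_real (1 / norm p) *\<^sub>C p"
    have "p \<in> complex_vector.span (insert b B)"
      unfolding p_def using b' mono
      by (intro complex_vector.span_diff) (auto intro: complex_vector.span_base)
    then have q: "q \<in> complex_vector.span (insert b B)"
      unfolding q_def by (rule complex_vector.span_scale)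
    have "norm q = 1"
      using False by (simp add: q_def norm_scaleC norm_divide)
    have orth_q: "cinner y q = 0" if "y \<in> complex_vector.span B" for y
      using orth[OF that] by (simp add: q_def cinner_scaleC_right)
    have "q \<notin> E"
      using orth_q[of q] E(2) \<open>norm q = 1\<close> by (auto simp: cinner_self)
    have "x = (\<Sum>e\<in>insert q E. cinner e x *\<^sub>C e)" 
      if x_span: "x \<in> complex_vector.span (insert b B)" for x
    proof -
      obtain k where k: "x - k *\<^sub>C b \<in> complex_vector.span B"
   
      using x_span unfolding complex_vector.span_breakdown_eq by blast
      define y where "y = (x - k *\<^sub>C b) + k *\<^sub>C b'"
      have y: "y \<in> complex_vector.span B"
        unfolding y_def using k b' by (intro complex_vector.span_add complex_vector.span_scale)
      have x: "x = y + k *\<^sub>C p"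
        by (simp add: y_def p_def scaleC.diff_right)
      have "cinner e x = cinner e y" if "e \<in> E" for e
        using orth[of e] that E(2) by (auto simp: x cinner_add_right cinner_scaleC_right)
      then have "(\<Sum>e\<in>E. cinner e x *\<^sub>C e) = y"
        using expand[OF y] by simp
      moreover have "cinner q y = 0"
        using orth_q[OF y] cinner_commute[of q y] by simp
      then have "cinner q x = k * of_real (norm p)"
        using False by (simp add: x q_def cinner_add_right cinner_scaleC_right cinner_scaleC_left
            cinner_self power2_eq_square)
      then have "cinner q x *\<^sub>C q = k *\<^sub>C p"
        using False by (simp add: q_def scaleC_scaleC)
      ultimately show ?thesis
        using E(1) \<open>q \<notin> E\<close> by (simp add: x add.commute)
    qed
    then show ?thesis
      using E q mono by (intro exI[of _ "insert q E"]) auto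
  qed
qed

section \<open>Krein and Pontryagin spaces\<close>

context krein_space
begin

lemma ip_eq_cinner: "ip x y = cinner x (J y)"
  by (metis J_J ip_J)

lemma cinner_J_left: "cinner (J x) y = cinner x (J y)"
  by (metis J_J ip_J ip_J_J)

lemma norm_J: "norm (J x) = norm x"
proof -
  have "cinner (J x) (J x) = cinner x x"
    by (simp add: cinner_J_left J_J)
  then have "complex_of_real ((norm (J x))\<^sup>2) = of_real ((norm x)\<^sup>2)"
    by (simp only: cinner_self)
  then have "(norm (J x))\<^sup>2 = (norm x)\<^sup>2"
    using of_real_eq_iff by blast
  then show ?thesis
    by simp
qed

lemma ip_add_left: "ip (x + y) z = ip x z + ip y z"
  by (simp add: ip_eq_cinner cinner_add_left)

lemma ip_scaleC_left: "ip (c *\<^sub>C x) y = cnj c * ip x y"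
  by (simp add: ip_eq_cinner cinner_scaleC_left)

lemma cmod_ip_le: "cmod (ip x y) \<le> norm x * norm y"
  using cmod_cinner_le[of x "J y"] by (simp add: ip_eq_cinner norm_J)

sublocale ip: bounded_bilinear ip
proof
  show "ip (r *\<^sub>R x) y = r *\<^sub>R ip x y" "ip x (r *\<^sub>R y) = r *\<^sub>R ip x y" for r x y
    by (simp_all add: scaleC_of_real[symmetric] ip_scaleC_left ip_scaleC_right scaleR_conv_of_real)
  show "\<exists>K. \<forall>x y. norm (ip x y) \<le> norm x * norm y * K"
    by (rule exI[of _ 1]) (simp add: cmod_ip_le)
qed (simp_all add: ip_add_left ip_add_right)

lemma eq_0_if_ip_eq_0:
  assumes "\<And>y. ip x y = 0"
  shows "x = 0"
  using assms[of "J x"] by (simp add: ip_J cinner_self)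

lemma subspace_orthogonal: "complex_vector.subspace {y. ip k y = 0}"
  by (rule complex_vector.subspaceI) (simp_all add: ip_add_right ip_scaleC_right ip.zero_right)

lemma closed_orthogonal: "closed {y. ip k y = 0}"
  by (intro closed_Collect_eq continuous_intros
      bounded_linear.continuous_on[OF ip.bounded_linear_right])

lemma orthogonal_closure_span:
  assumes "\<And>y. y \<in> B \<Longrightarrow> ip k y = 0" and "x \<in> closure (complex_vector.span B)"
  shows "ip k x = 0"
proof -
  have "complex_vector.span B \<subseteq> {y. ip k y = 0}"
    using assms(1) by (intro complex_vector.span_minimal subspace_orthogonal) auto
  then have "closure (complex_vector.span B) \<subseteq> {y. ip k y = 0}"
    by (intro closure_minimal closed_orthogonal)
  then show ?thesis
    using assms(2) by blast
qed

lemma span_dense_if_total: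
  assumes "\<And>k. (\<And>y. y \<in> B \<Longrightarrow> ip k y = 0) \<Longrightarrow> k = 0"
  shows "closure (complex_vector.span B) = UNIV"
proof (rule ccontr)
  let ?M = "closure (complex_vector.span B)"
  assume "?M \<noteq> UNIV"
  then obtain h where "h \<notin> ?M"
    by blast
  then obtain g where g: "\<And>m. m \<in> ?M \<Longrightarrow> cinner m g = 0" "cinner h g \<noteq> 0"
    using orthogonal_to_closed_subspace[of ?M h] complex_subspace_closure by auto
  have "ip (J g) y = 0" if "y \<in> B" for y
  proof -
    have "y \<in> ?M"
      using that closure_subset complex_vector.span_base by blast
    then have "cinner y g = 0"
      by (rule g(1))
    then show ?thesis
      using cinner_commute[of g y] by (simp add: ip_eq_cinner cinner_J_left J_J)
  qed
  then have "J g = 0"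
    by (rule assms)
  then have "g = 0"
    using norm_J[of g] by simp
  then show False
    using g(2) by (simp add: cinner.zero_right)
qed

end

text \<open>
  The finite rank of indefiniteness enters the proof only through the following estimate: up to
  finitely many functionals, the indefinite form controls the norm. If the eigenspace of \<open>J\<close> for
  the eigenvalue \<open>s = \<plusminus>1\<close> is finite-dimensional and \<open>P = (I + s J) / 2\<close> is the projection onto it,
  then \<open>\<parallel>x\<parallel>\<^sup>2 = 2 \<parallel>P x\<parallel>\<^sup>2 - s [x, x]\<close>, and \<open>\<parallel>P x\<parallel>\<^sup>2\<close> is expanded in an orthonormal basis \<open>E\<close>.
\<close>

lemma (in pontryagin_space) norm_square_le_ip:
  "\<exists>E. finite E \<and> (\<forall>x. (norm x)\<^sup>2 \<le> cmod (ip x x) + 2 * (\<Sum>e\<in>E. (cmod (ip e x))\<^sup>2))"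
proof -
  have "cdim {x. J x = x} < \<infinity> \<or> cdim {x. J x = - x} < \<infinity>"
    using finite_rank by (auto simp: min_def split: if_splits)
  then obtain s :: real where s: "s = 1 \<or> s = -1" and "cdim {x. J x = s *\<^sub>R x} < \<infinity>"
    using that[of 1] that[of "-1"] by auto
  then obtain B0 where B0: "finite B0" "{x. J x = s *\<^sub>R x} \<subseteq> complex_vector.span B0"
    by (auto simp: cdim_def split: if_splits)
  let ?W = "{x. J x = s *\<^sub>R x}"
  obtain B where B: "B \<subseteq> ?W" "complex_vector.independent B" "?W \<subseteq> complex_vector.span B"
    using complex_vector.maximal_independent_subset[of ?W] by metis
  have "finite B"
    using complex_vector.independent_span_bound[OF B0(1) B(2) subset_trans[OF B(1) B0(2)]] ..
  then obtain E where E: "finite E" "E \<subseteq> complex_vector.span B"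
    and expand: "\<forall>x\<in>complex_vector.span B. x = (\<Sum>e\<in>E. cinner e x *\<^sub>C e)"
    using finite_orthonormal_expansion by metis
  have J_scaleR: "J (r *\<^sub>R x) = r *\<^sub>R J x" for r x
    by (metis J_scaleC scaleC_of_real)
  have J_0: "J 0 = 0"
    using J_scaleR[of 0] by simp
  have "complex_vector.subspace ?W"
    by (rule complex_vector.subspaceI)
      (simp_all add: J_0 J_add scaleR_add_right J_scaleC scaleC.scaleR_right)
  then have "E \<subseteq> ?W"
    using E(2) B(1) complex_vector.span_minimal by blast
  have "(norm x)\<^sup>2 \<le> cmod (ip x x) + 2 * (\<Sum>e\<in>E. (cmod (ip e x))\<^sup>2)" for x
  proof -
    have ss: "s * s = 1"
      using s by auto
    define p where "p = (1/2) *\<^sub>R (x + s *\<^sub>R J x)"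
    have "J p = s *\<^sub>R p"
      by (simp add: p_def J_scaleR J_add J_J ss scaleR_add_right add.commute)
    then have "p \<in> complex_vector.span B"
      using B(3) by blast
    have coeff: "cmod (cinner e p) = cmod (ip e x)" if "e \<in> E" for e
    proof -
      have Je: "J e = s *\<^sub>R e"
        using that \<open>E \<subseteq> ?W\<close> by blast
      have "cinner e (J x) = s *\<^sub>R cinner e x"
        unfolding cinner_J_left[symmetric] Je by (rule cinner.scaleR_left)
      then have "cinner e p = cinner e x" "ip e x = s *\<^sub>R cinner e x"
        by (simp_all add: p_def cinner.scaleR_right cinner_add_right ip_eq_cinner ss)
      then show ?thesis
        using s by auto
    qed
    have "complex_of_real ((norm p)\<^sup>2) = (\<Sum>e\<in>E. cinner e p * cinner p e)"
      unfolding cinner_self[symmetric]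
      by (subst (2) expand[rule_format, OF \<open>p \<in> complex_vector.span B\<close>])
        (simp add: cinner.sum_right cinner_scaleC_right)
    also have "\<dots> = of_real (\<Sum>e\<in>E. (cmod (ip e x))\<^sup>2)"
      unfolding of_real_sum
      by (intro sum.cong refl) (simp add: coeff[symmetric] cinner_commute[of p]
        complex_norm_square del: of_real_power)
    finally have norm_p: "(norm p)\<^sup>2 = (\<Sum>e\<in>E. (cmod (ip e x))\<^sup>2)"
      using of_real_eq_iff by blast
    have "4 * (norm p)\<^sup>2 = inner (x + s *\<^sub>R J x) (x + s *\<^sub>R J x)"
      by (simp add: p_def power_divide flip: power2_norm_eq_inner)
    also have "\<dots> = inner x x + 2 * s * inner x (J x) + (s * s) * inner (J x) (J x)"
      by (simp add: inner_add_left inner_add_right inner_commute[of "J x" x] algebra_simps)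
    also have "\<dots> = 2 * (norm x)\<^sup>2 + 2 * s * Re (ip x x)"
      by (simp add: ss ip_eq_cinner Re_cinner power2_norm_eq_inner[symmetric] norm_J)
    finally have "(norm x)\<^sup>2 = 2 * (norm p)\<^sup>2 - s * Re (ip x x)"
      by simp
    moreover have "- s * Re (ip x x) \<le> cmod (ip x x)"
      using s abs_Re_le_cmod[of "ip x x"] by auto
    ultimately show ?thesis
      using norm_p by simp
  qed
  then show ?thesis
    using E(1) by blast
qed

section \<open>Isometric relations between Pontryagin spaces\<close>

text \<open>
  Up to finitely many numbers \<open>[e, g]\<close>, the norm of \<open>g\<close> is controlled by \<open>[g, g] = [f, f]\<close>. Since
  the range is dense, each \<open>e\<close> can be replaced by some \<open>b\<close> with \<open>(a, b) \<in> G\<close> at the cost of a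
  small multiple of \<open>\<parallel>g\<parallel>\<close>, and then \<open>[b, g] = [a, f]\<close> is controlled by \<open>\<parallel>f\<parallel>\<close>.
\<close>

lemma isometric_relation_bounded:
  assumes "krein_space J ip" and "pontryagin_space J' ip'"
    and iso: "\<And>f g a b. (f, g) \<in> G \<Longrightarrow> (a, b) \<in> G \<Longrightarrow> ip' g b = ip f a"
    and dense: "closure (Range G) = UNIV"
  shows "\<exists>C. \<forall>(f, g)\<in>G. norm g \<le> C * norm f"
proof -
  interpret H: krein_space J ip by fact
  interpret K: pontryagin_space J' ip' by fact
  obtain E where E: "finite E"
    and est: "\<And>x. (norm x)\<^sup>2 \<le> cmod (ip' x x) + 2 * (\<Sum>e\<in>E. (cmod (ip' e x))\<^sup>2)"
    using K.norm_square_le_ip by blast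
  \<comment> \<open>so small that the error terms add up to at most half of \<open>\<parallel>g\<parallel>\<^sup>2\<close>\<close>
  define \<epsilon> where "\<epsilon> = 1 / (4 * (real (card E) + 1))"
  have \<epsilon>: "\<epsilon> > 0" "4 * card E * \<epsilon>\<^sup>2 \<le> 1 / 2"
  proof -
    show "\<epsilon> > 0"
      by (simp add: \<epsilon>_def)
    have "4 * real (card E) * \<epsilon> \<le> 1" "\<epsilon> \<le> 1 / 2"
      by (simp_all add: \<epsilon>_def field_simps)
    then have "(4 * real (card E) * \<epsilon>) * \<epsilon> \<le> 1 * (1 / 2)"
      using \<open>\<epsilon> > 0\<close> by (intro mult_mono) auto
    then show "4 * card E * \<epsilon>\<^sup>2 \<le> 1 / 2"
      by (simp add: power2_eq_square mult.assoc)
  qed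
  have "\<exists>a b. (a, b) \<in> G \<and> norm (e - b) < \<epsilon>" for e
  proof -
    have "e \<in> closure (Range G)"
      using dense by simp
    then obtain b where "b \<in> Range G" "dist b e < \<epsilon>"
      unfolding closure_approachable using \<epsilon>(1) by blast
    then show ?thesis
      by (auto simp: dist_norm norm_minus_commute)
  qed
  then obtain a b where ab: "\<And>e. (a e, b e) \<in> G" "\<And>e. norm (e - b e) < \<epsilon>"
    by metis
  define A where "A = (\<Sum>e\<in>E. (norm (a e))\<^sup>2)"
  have "A \<ge> 0"
    unfolding A_def by (intro sum_nonneg) simp
  have "norm g \<le> sqrt (2 + 8 * A) * norm f" if "(f, g) \<in> G" for f g
  proof -
    have "(cmod (ip' e g))\<^sup>2 \<le> 2 * \<epsilon>\<^sup>2 * (norm g)\<^sup>2 + 2 * (norm (a e))\<^sup>2 * (norm f)\<^sup>2" for e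
    proof -
      have "ip' e g = ip' (e - b e) g + ip (a e) f"
        using iso[OF ab(1)[of e] that] by (simp add: K.ip.diff_left)
      also have "cmod \<dots> \<le> norm (e - b e) * norm g + norm (a e) * norm f"
        using K.cmod_ip_le H.cmod_ip_le by (intro norm_triangle_le add_mono)
      also have "\<dots> \<le> \<epsilon> * norm g + norm (a e) * norm f"
        using ab(2)[of e] by (intro add_right_mono mult_right_mono) auto
      finally have "(cmod (ip' e g))\<^sup>2 \<le> (\<epsilon> * norm g + norm (a e) * norm f)\<^sup>2"
        by (intro power_mono) auto
      also have "\<dots> \<le> 2 * (\<epsilon> * norm g)\<^sup>2 + 2 * (norm (a e) * norm f)\<^sup>2"
        using sum_squares_bound[of "\<epsilon> * norm g" "norm (a e) * norm f"] by (simp add: power2_sum)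
      finally show ?thesis
        by (simp add: power_mult_distrib)
    qed
    then have "(\<Sum>e\<in>E. (cmod (ip' e g))\<^sup>2)
        \<le> (\<Sum>e\<in>E. 2 * \<epsilon>\<^sup>2 * (norm g)\<^sup>2 + 2 * (norm (a e))\<^sup>2 * (norm f)\<^sup>2)"
      by (intro sum_mono)
    also have "\<dots> = 2 * card E * \<epsilon>\<^sup>2 * (norm g)\<^sup>2 + 2 * A * (norm f)\<^sup>2"
      by (simp add: sum.distrib A_def sum_distrib_left sum_distrib_right)
    finally have "(norm g)\<^sup>2
        \<le> cmod (ip' g g) + 4 * card E * \<epsilon>\<^sup>2 * (norm g)\<^sup>2 + 4 * A * (norm f)\<^sup>2"
      using est[of g] by simp
    moreover have "4 * card E * \<epsilon>\<^sup>2 * (norm g)\<^sup>2 \<le> 1 / 2 * (norm g)\<^sup>2"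
      using \<epsilon>(2) by (intro mult_right_mono) auto
    moreover have "cmod (ip' g g) \<le> (norm f)\<^sup>2"
      using iso[OF that that] H.cmod_ip_le[of f f] by (simp add: power2_eq_square)
    ultimately have "(norm g)\<^sup>2 \<le> (2 + 8 * A) * (norm f)\<^sup>2"
      by (simp add: algebra_simps)
    then have "(norm g)\<^sup>2 \<le> (sqrt (2 + 8 * A) * norm f)\<^sup>2"
      using \<open>A \<ge> 0\<close> by (simp add: power_mult_distrib)
    then show ?thesis
      by (rule power2_le_imp_le) (simp add: \<open>A \<ge> 0\<close>)
  qed
  then show ?thesis
    by blast
qed

lemma linear_relation_converse:
  assumes "linear_relation R"
  shows "linear_relation (R\<inverse>)"
proof (rule complex_vector.subspaceI)
  show "0 \<in> R\<inverse>"
    using complex_vector.subspace_0[OF assms] by (simp add: zero_prod_def)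
  show "x + y \<in> R\<inverse>" if "x \<in> R\<inverse>" "y \<in> R\<inverse>" for x y
    using that complex_vector.subspace_add[OF assms, of "(snd x, fst x)" "(snd y, fst y)"]
    by (cases x, cases y) simp
  show "c *\<^sub>C x \<in> R\<inverse>" if "x \<in> R\<inverse>" for c x
    using that complex_vector.subspace_scale[OF assms, of "(snd x, fst x)" c]
    by (cases x) (simp add: scaleC_prod_def)
qed

lemma closed_bounded_relation_total:
  fixes G :: "('a::complex_hilbert \<times> 'b::complex_hilbert) set"
  assumes "linear_relation G" and "closed G" and "closure (Domain G) = UNIV"
    and bound: "\<And>f g. (f, g) \<in> G \<Longrightarrow> norm g \<le> C * norm f"
  shows "\<exists>g. (f, g) \<in> G"
proof -
  have "f \<in> closure (Domain G)"
    using assms(3) by simp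
  then obtain X where X: "\<And>n::nat. X n \<in> Domain G" "X \<longlonglongrightarrow> f"
    unfolding closure_sequential by blast
  then obtain Y where Y: "\<And>n. (X n, Y n) \<in> G"
    by (meson DomainE)
  have *: "norm (Y m - Y n) \<le> C * norm (X m - X n)" for m n
    using complex_vector.subspace_diff[OF assms(1) Y[of m] Y[of n]] by (intro bound) simp
  have "Cauchy Y"
  proof (rule metric_CauchyI)
    fix e :: real assume "e > 0"
    then obtain N where N: "\<And>m n. m \<ge> N \<Longrightarrow> n \<ge> N \<Longrightarrow> dist (X m) (X n) < e / (\<bar>C\<bar> + 1)"
      using metric_CauchyD[OF LIMSEQ_imp_Cauchy[OF X(2)], of "e / (\<bar>C\<bar> + 1)"] by auto
    have "dist (Y m) (Y n) < e" if "m \<ge> N" "n \<ge> N" for m n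
    proof -
      have "dist (Y m) (Y n) \<le> (\<bar>C\<bar> + 1) * dist (X m) (X n)"
        unfolding dist_norm using *[of m n]
        by (rule order_trans) (intro mult_right_mono, auto)
      also have "\<dots> < e"
        using N[OF that] by (simp add: pos_less_divide_eq mult.commute)
      finally show ?thesis .
    qed
    then show "\<exists>N. \<forall>m\<ge>N. \<forall>n\<ge>N. dist (Y m) (Y n) < e"
      by blast
  qed
  then obtain g where "Y \<longlonglongrightarrow> g"
    using Cauchy_convergent_iff convergent_def by blast
  with X(2) have "(\<lambda>n. (X n, Y n)) \<longlonglongrightarrow> (f, g)"
    by (rule tendsto_Pair)
  with assms(2) Y have "(f, g) \<in> G"
    by (rule closed_sequentially)
  then show ?thesis ..
qed

text \<open>The closure of an isometric relation with dense domain and dense range is bounded in both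
  directions, which makes it the graph of a bijection.\<close>

theorem isometric_relation_extends_to_standard_unitary:
  fixes G :: "('h::complex_hilbert \<times> 'k::complex_hilbert) set"
  assumes "pontryagin_space J ip" and "pontryagin_space J' ip'" and "linear_relation G"
    and iso: "\<And>f g a b. (f, g) \<in> G \<Longrightarrow> (a, b) \<in> G \<Longrightarrow> ip' g b = ip f a"
    and "closure (Domain G) = UNIV" and "closure (Range G) = UNIV"
  shows "\<exists>U. standard_unitary ip ip' U \<and> (\<forall>(f, g)\<in>G. U f = g)"
proof -
  interpret H: pontryagin_space J ip by fact
  interpret K: pontryagin_space J' ip' by fact
  obtain C where "\<forall>(f, g)\<in>G. norm g \<le> C * norm f"
    using isometric_relation_bounded[OF H.krein_space_axioms assms(2) iso assms(6)] by blast
  then have "G \<subseteq> {(f, g). norm g \<le> C * norm f}"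
    by blast
  then have "closure G \<subseteq> {(f, g). norm g \<le> C * norm f}"
    by (intro closure_minimal)
      (auto simp: case_prod_unfold intro!: closed_Collect_le continuous_intros)
  then have C: "norm g \<le> C * norm f" if "(f, g) \<in> closure G" for f g
    using that by blast
  have "\<exists>D. \<forall>(g, f)\<in>G\<inverse>. norm f \<le> D * norm g"
    using iso assms(5)
    by (intro isometric_relation_bounded[OF K.krein_space_axioms assms(1)]) auto
  then obtain D where "G \<subseteq> {(f, g). norm f \<le> D * norm g}"
    by blast
  then have "closure G \<subseteq> {(f, g). norm f \<le> D * norm g}"
    by (intro closure_minimal)
      (auto simp: case_prod_unfold intro!: closed_Collect_le continuous_intros)
  then have D: "norm f \<le> D * norm g" if "(f, g) \<in> closure G" for f g
    using that by blast
  have lin: "linear_relation (closure G)"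
    using assms(3) by (rule complex_subspace_closure)
  have sub: "G \<subseteq> closure G"
    by (rule closure_subset)
  have dom: "closure (Domain (closure G)) = UNIV"
    using closure_mono[OF Domain_mono[OF sub]] assms(5) by auto
  have total: "\<exists>g. (f, g) \<in> closure G" for f
    using closed_bounded_relation_total[OF lin closed_closure dom C] .
  have onto: "\<exists>f. (f, g) \<in> closure G" for g
  proof -
    let ?G = "(closure G)\<inverse>"
    have "linear_relation ?G"
      using lin by (rule linear_relation_converse)
    moreover have "closed ?G"
    proof -
      have "?G = prod.swap -` closure G"
        by auto
      then show ?thesis
        using closed_vimage[OF closed_closure continuous_on_swap] by auto
    qed
    moreover have "closure (Domain ?G) = UNIV"
      using closure_mono[OF Range_mono[OF sub]] assms(6) by auto
    ultimately show ?thesis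
      using closed_bounded_relation_total[of ?G D g] D by auto
  qed
  have diff: "(f - a, g - b) \<in> closure G" if "(f, g) \<in> closure G" "(a, b) \<in> closure G" for f g a b
    using complex_vector.subspace_diff[OF lin that] by simp
  have unique: "g = b" if "(f, g) \<in> closure G" "(f, b) \<in> closure G" for f g b
    using C[OF diff[OF that]] by simp
  have unique': "f = a" if "(f, g) \<in> closure G" "(a, g) \<in> closure G" for f g a
    using D[OF diff[OF that]] by simp
  obtain U where U: "\<And>f. (f, U f) \<in> closure G"
    using total by metis
  have U_eq: "U f = g" if "(f, g) \<in> closure G" for f g
    using unique[OF U that] .
  have U_add: "U (x + y) = U x + U y" for x y
    using complex_vector.subspace_add[OF lin U[of x] U[of y]] by (intro U_eq) simp
  have U_scale: "U (c *\<^sub>C x) = c *\<^sub>C U x" for c x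
    using complex_vector.subspace_scale[OF lin U[of x], of c] by (intro U_eq) (simp add: scaleC_prod_def)
  have "bounded_linear U"
  proof (rule bounded_linear_intro)
    show "U (r *\<^sub>R x) = r *\<^sub>R U x" for r x
      by (metis U_scale scaleC_of_real)
    show "norm (U x) \<le> norm x * C" for x
      using C[OF U] by (simp add: mult.commute)
  qed (rule U_add)
  moreover have "bij U"
  proof (rule bijI)
    show "inj U"
      by (rule injI) (metis U unique')
    show "surj U"
      using onto U_eq by (metis surjI)
  qed
  moreover have "ip' (U f) (U h) = ip f h" for f h
  proof -
    obtain X where X: "\<And>n::nat. X n \<in> G" "X \<longlonglongrightarrow> (f, U f)"
      using U[of f] unfolding closure_sequential by blast
    obtain Y where Y: "\<And>n::nat. Y n \<in> G" "Y \<longlonglongrightarrow> (h, U h)"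
      using U[of h] unfolding closure_sequential by blast
    have "(\<lambda>n. ip' (snd (X n)) (snd (Y n))) \<longlonglongrightarrow> ip' (U f) (U h)"
      using tendsto_snd[OF X(2)] tendsto_snd[OF Y(2)] by (intro K.ip.tendsto) simp_all
    moreover have "ip' (snd (X n)) (snd (Y n)) = ip (fst (X n)) (fst (Y n))" for n
      using X(1) Y(1) by (intro iso) simp_all
    moreover have "(\<lambda>n. ip (fst (X n)) (fst (Y n))) \<longlonglongrightarrow> ip f h"
      using tendsto_fst[OF X(2)] tendsto_fst[OF Y(2)] by (intro H.ip.tendsto) simp_all
    ultimately show ?thesis
      using LIMSEQ_unique by auto
  qed
  moreover have "\<forall>(f, g)\<in>G. U f = g"
    using U_eq sub by blast
  ultimately show ?thesis
    unfolding standard_unitary_def using U_scale by blast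
qed

section \<open>Simple symmetric relations in Pontryagin spaces\<close>

lemma common_convergent_subsequence:
  fixes a :: "'e \<Rightarrow> nat \<Rightarrow> 'a::heine_borel"
  assumes "finite E" and "\<And>e. e \<in> E \<Longrightarrow> bounded (range (a e))"
  shows "\<exists>r. strict_mono (r :: nat \<Rightarrow> nat) \<and> (\<forall>e\<in>E. convergent (a e \<circ> r))"
  using assms
proof induction
  case empty
  show ?case
    using strict_mono_id by blast
next
  case (insert e E)
  then obtain r where r: "strict_mono (r :: nat \<Rightarrow> nat)" "\<forall>e\<in>E. convergent (a e \<circ> r)"
    by blast
  have "bounded (range (a e \<circ> r))"
    using insert.prems[of e] by (rule bounded_subset) auto
  then obtain l q where q: "strict_mono (q :: nat \<Rightarrow> nat)" "((a e \<circ> r) \<circ> q) \<longlonglongrightarrow> l"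
    using bounded_imp_convergent_subsequence by blast
  have "convergent (a e' \<circ> (r \<circ> q))" if "e' \<in> insert e E" for e'
    using that q r(2) convergent_subseq_convergent[OF _ q(1), of "a e' \<circ> r"]
    by (auto simp: comp_assoc convergent_def)
  then show ?case
    using strict_mono_o[OF r(1) q(1)] by blast
qed

text \<open>The range of \<open>T - zI\<close>.\<close>

definition shifted_range :: "complex \<Rightarrow> ('h::complex_hilbert \<times> 'h) set \<Rightarrow> 'h set" where
  "shifted_range z T = (\<lambda>x. snd x - z *\<^sub>C fst x) ` T"

lemma shifted_rangeI: "(f, f') \<in> T \<Longrightarrow> f' - z *\<^sub>C f \<in> shifted_range z T"
  unfolding shifted_range_def by (rule image_eqI[of _ _ "(f, f')"]) simp_all

lemma shifted_rangeE:
  assumes "y \<in> shifted_range z T"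
  obtains f f' where "(f, f') \<in> T" "y = f' - z *\<^sub>C f"
  using assms unfolding shifted_range_def by force

lemma subspace_shifted_range:
  assumes "linear_relation T"
  shows "complex_vector.subspace (shifted_range z T)"
proof (rule complex_vector.subspaceI)
  show "0 \<in> shifted_range z T"
    using shifted_rangeI[of 0 0 T z] complex_vector.subspace_0[OF assms]
    by (simp add: zero_prod_def scaleC.zero_right)
  show "x + y \<in> shifted_range z T"
    if x: "x \<in> shifted_range z T" and y: "y \<in> shifted_range z T" for x y
  proof -
    obtain f f' where "(f, f') \<in> T" "x = f' - z *\<^sub>C f"
      using x by (rule shifted_rangeE)
    moreover obtain g g' where "(g, g') \<in> T" "y = g' - z *\<^sub>C g"
      using y by (rule shifted_rangeE)
    ultimately show ?thesis
      using shifted_rangeI[of "f + g" "f' + g'" T z]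
        complex_vector.subspace_add[OF assms, of "(f, f')" "(g, g')"]
      by (simp add: scaleC_add_right add_diff_add)
  qed
  show "c *\<^sub>C x \<in> shifted_range z T" if x: "x \<in> shifted_range z T" for c x
  proof -
    obtain f f' where "(f, f') \<in> T" "x = f' - z *\<^sub>C f"
      using x by (rule shifted_rangeE)
    then show ?thesis
      using shifted_rangeI[of "c *\<^sub>C f" "c *\<^sub>C f'" T z]
        complex_vector.subspace_scale[OF assms, of "(f, f')" c]
      by (simp add: scaleC_prod_def scaleC.diff_right scaleC_scaleC mult.commute)
  qed
qed

locale simple_symmetric_relation = pontryagin_space J ip
  for J :: "'h::complex_hilbert \<Rightarrow> 'h" and ip +
  fixes T :: "('h \<times> 'h) set"
  assumes simple: "simple_symmetric ip T"
begin

abbreviation adj :: "('h \<times> 'h) set" where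
  "adj \<equiv> adjoint_rel ip T"

lemma linear_T: "linear_relation T" and closed_T: "closed T" and T_subset_adj: "T \<subseteq> adj"
  using simple unfolding simple_symmetric_def closed_symmetric_def by simp_all

lemma adjD: "(g, g') \<in> adj \<Longrightarrow> (f, f') \<in> T \<Longrightarrow> ip f g' = ip f' g"
  unfolding adjoint_rel_def by (drule CollectD) fastforce

lemma eigenvalue_real: "(f, z *\<^sub>C f) \<in> T \<Longrightarrow> z \<notin> \<real> \<Longrightarrow> f = 0"
proof -
  assume f: "(f, z *\<^sub>C f) \<in> T" and "z \<notin> \<real>"
  then have "eigenspace z T = {0}"
    using simple by (simp add: simple_symmetric_def)
  then show "f = 0"
    using f unfolding eigenspace_def by blast
qed

text \<open>The identity \<open>2 i Im z [f, f] = [k, f] - [f, k]\<close> for \<open>k = f' - z f\<close>.\<close>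

lemma cmod_ip_le_shift:
  assumes "(f, f') \<in> T"
  shows "\<bar>Im z\<bar> * cmod (ip f f) \<le> norm f * norm (f' - z *\<^sub>C f)"
proof -
  define k where "k = f' - z *\<^sub>C f"
  have "ip f f' = ip f' f"
    by (rule adjD[OF subsetD[OF T_subset_adj assms] assms])
  then have "ip k f - ip f k = (z - cnj z) * ip f f"
    by (simp add: k_def ip.diff_left ip.diff_right ip_scaleC_left ip_scaleC_right algebra_simps)
  then have "2 * \<bar>Im z\<bar> * cmod (ip f f) = cmod (ip k f - ip f k)"
    by (simp add: complex_diff_cnj norm_mult)
  also have "\<dots> \<le> norm k * norm f + norm f * norm k"
    using cmod_ip_le by (intro norm_triangle_le_diff add_mono)
  finally show ?thesis
    by (simp add: k_def mult.commute)
qed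

text \<open>
  In a Hilbert space \<open>c = |Im z|\<close> works. In general, take unit vectors \<open>f\<^sub>n\<close> that violate the claim
  for \<open>c = 1 / n\<close>. The finitely many functionals that control the norm together with the form
  converge along a subsequence, and the form itself is small on differences by the preceding lemma,
  so \<open>f\<^sub>n\<close> converges. Its limit is a non-real eigenvector.
\<close>

lemma shift_bounded_below:
  assumes "z \<notin> \<real>"
  shows "\<exists>c>0. \<forall>(f, f')\<in>T. c * norm f \<le> norm (f' - z *\<^sub>C f)"
proof (rule ccontr)
  assume contr: "\<not> ?thesis"
  have "Im z \<noteq> 0"
    using assms complex_is_Real_iff by blast
  have "\<exists>f f'. (f, f') \<in> T \<and> norm f = 1 \<and> norm (f' - z *\<^sub>C f) < 1 / Suc n" for n
  proof -
    have "(0::real) < 1 / Suc n"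
      by simp
    with contr have "\<not> (\<forall>(f, f')\<in>T. 1 / Suc n * norm f \<le> norm (f' - z *\<^sub>C f))"
      by blast
    then obtain f f' where f: "(f, f') \<in> T" "norm (f' - z *\<^sub>C f) < 1 / Suc n * norm f"
      by force
    then have "f \<noteq> 0"
      by auto
    define c where "c = complex_of_real (1 / norm f)"
    have c: "cmod c = 1 / norm f"
      by (simp add: c_def norm_divide)
    have "(c *\<^sub>C f, c *\<^sub>C f') \<in> T"
      using complex_vector.subspace_scale[OF linear_T f(1), of c] by (simp add: scaleC_prod_def)
    moreover have "norm (c *\<^sub>C f) = 1"
      using \<open>f \<noteq> 0\<close> by (simp add: norm_scaleC c)
    moreover have "c *\<^sub>C f' - z *\<^sub>C c *\<^sub>C f = c *\<^sub>C (f' - z *\<^sub>C f)"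
      by (simp add: scaleC.diff_right scaleC_scaleC mult.commute)
    then have "norm (c *\<^sub>C f' - z *\<^sub>C c *\<^sub>C f) < 1 / Suc n"
      using f(2) \<open>f \<noteq> 0\<close> by (simp only: norm_scaleC c) (simp add: field_simps)
    ultimately show ?thesis
      by blast
  qed
  then obtain F F' where F: "\<And>n. (F n, F' n) \<in> T" "\<And>n. norm (F n) = 1"
    "\<And>n. norm (F' n - z *\<^sub>C F n) < 1 / Suc n"
    by metis
  obtain E where E: "finite E"
    and est: "\<And>x. (norm x)\<^sup>2 \<le> cmod (ip x x) + 2 * (\<Sum>e\<in>E. (cmod (ip e x))\<^sup>2)"
    using norm_square_le_ip by metis
  have "bounded (range (\<lambda>n. ip e (F n)))" for e
    using cmod_ip_le[of e] F(2) by (intro boundedI[of _ "norm e"]) (metis mult.right_neutral rangeE)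
  then obtain r where r: "strict_mono (r :: nat \<Rightarrow> nat)" "\<forall>e\<in>E. convergent ((\<lambda>n. ip e (F n)) \<circ> r)"
    using common_convergent_subsequence[OF E, of "\<lambda>e n. ip e (F n)"] by blast
  define X where "X = F \<circ> r"
  define K where "K = (\<lambda>n. F' (r n) - z *\<^sub>C F (r n))"
  have X_T: "(X n, z *\<^sub>C X n + K n) \<in> T" for n
    using F(1)[of "r n"] by (simp add: X_def K_def)
  have norm_X: "norm (X n) = 1" for n
    by (simp add: X_def F(2))
  have "\<forall>e\<in>E. \<exists>l. (\<lambda>n. ip e (X n)) \<longlonglongrightarrow> l"
    using r(2) by (auto simp: convergent_def X_def o_def)
  then obtain l where l: "\<And>e. e \<in> E \<Longrightarrow> (\<lambda>n. ip e (X n)) \<longlonglongrightarrow> l e"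
    by metis
  have "(\<lambda>n. 1 / real (Suc (r n))) \<longlonglongrightarrow> 0"
    using LIMSEQ_subseq_LIMSEQ[OF LIMSEQ_inverse_real_of_nat r(1)]
    by (simp add: o_def divide_inverse)
  then have K: "K \<longlonglongrightarrow> 0"
    by (rule Lim_null_comparison[rotated]) (simp add: K_def less_imp_le[OF F(3)] del: of_nat_Suc)
  define b where "b = (\<lambda>n. 2 / \<bar>Im z\<bar> * norm (K n) + 4 * (\<Sum>e\<in>E. (cmod (ip e (X n) - l e))\<^sup>2))"
  have "b \<longlonglongrightarrow> 2 / \<bar>Im z\<bar> * norm (0::'h) + 4 * (\<Sum>e\<in>E. (cmod (l e - l e))\<^sup>2)"
    unfolding b_def by (intro tendsto_intros K l)
  then have "b \<longlonglongrightarrow> 0"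
    by simp
  moreover have "(dist (X m) (X n))\<^sup>2 \<le> b m + b n" for m n
  proof -
    define x where "x = X m - X n"
    define k where "k = K m - K n"
    have "(x, z *\<^sub>C x + k) \<in> T"
      using complex_vector.subspace_diff[OF linear_T X_T[of m] X_T[of n]]
      by (simp add: x_def k_def scaleC.diff_right algebra_simps)
    then have "\<bar>Im z\<bar> * cmod (ip x x) \<le> norm x * norm k"
      using cmod_ip_le_shift[of x "z *\<^sub>C x + k" z] by simp
    also have "\<dots> \<le> 2 * (norm (K m) + norm (K n))"
      using norm_triangle_ineq4[of "X m" "X n"] norm_triangle_ineq4[of "K m" "K n"]
      by (intro mult_mono) (simp_all add: x_def k_def norm_X)
    finally have "cmod (ip x x) \<le> 2 / \<bar>Im z\<bar> * (norm (K m) + norm (K n))"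
      using \<open>Im z \<noteq> 0\<close> by (simp add: field_simps)
    moreover have "(cmod (ip e x))\<^sup>2
        \<le> 2 * (cmod (ip e (X m) - l e))\<^sup>2 + 2 * (cmod (ip e (X n) - l e))\<^sup>2" for e
    proof -
      have "ip e x = (ip e (X m) - l e) - (ip e (X n) - l e)"
        by (simp add: x_def ip.diff_right)
      then have "cmod (ip e x) \<le> cmod (ip e (X m) - l e) + cmod (ip e (X n) - l e)"
        using norm_triangle_ineq4 by metis
      then have "(cmod (ip e x))\<^sup>2 \<le> (cmod (ip e (X m) - l e) + cmod (ip e (X n) - l e))\<^sup>2"
        by (intro power_mono) auto
      also have "\<dots> \<le> 2 * (cmod (ip e (X m) - l e))\<^sup>2 + 2 * (cmod (ip e (X n) - l e))\<^sup>2"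
        using sum_squares_bound[of "cmod (ip e (X m) - l e)" "cmod (ip e (X n) - l e)"]
        by (simp add: power2_sum)
      finally show ?thesis .
    qed
    then have "(\<Sum>e\<in>E. (cmod (ip e x))\<^sup>2)
        \<le> (\<Sum>e\<in>E. 2 * (cmod (ip e (X m) - l e))\<^sup>2 + 2 * (cmod (ip e (X n) - l e))\<^sup>2)"
      by (intro sum_mono)
    ultimately have "(norm x)\<^sup>2 \<le> b m + b n"
      using est[of x] by (simp add: b_def sum.distrib sum_distrib_left[symmetric] add_divide_distrib
          algebra_simps)
    then show ?thesis
      by (simp add: x_def dist_norm)
  qed
  ultimately have "Cauchy X"
    by (rule Cauchy_if_dist_square_le[rotated])
  then obtain f where f: "X \<longlonglongrightarrow> f"
    using Cauchy_convergent_iff convergent_def by metis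
  have "(\<lambda>n. (X n, z *\<^sub>C X n + K n)) \<longlonglongrightarrow> (f, z *\<^sub>C f + 0)"
    by (intro tendsto_Pair tendsto_add scaleC.tendsto tendsto_const f K)
  with closed_T X_T have "(f, z *\<^sub>C f + 0) \<in> T"
    by (rule closed_sequentially)
  then have "f = 0"
    using eigenvalue_real assms by simp
  moreover have "norm f = 1"
    using LIMSEQ_unique[OF tendsto_norm[OF f]] by (simp add: norm_X)
  ultimately show False
    by simp
qed

lemma closed_shifted_range:
  assumes "z \<notin> \<real>"
  shows "closed (shifted_range z T)"
proof -
  obtain c where c: "c > 0" "\<And>f f'. (f, f') \<in> T \<Longrightarrow> c * norm f \<le> norm (f' - z *\<^sub>C f)"
    using shift_bounded_below[OF assms] by blast
  define C where "C = (1 + cmod z) / c + 1"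
  have "C > 0"
    unfolding C_def using c(1) by (intro add_nonneg_pos divide_nonneg_pos) auto
  have bound: "1 / C * norm x \<le> norm (snd x - z *\<^sub>C fst x)" if "x \<in> T" for x
  proof -
    define k where "k = snd x - z *\<^sub>C fst x"
    have f: "norm (fst x) \<le> norm k / c"
      using c(1) c(2)[of "fst x" "snd x"] that by (simp add: k_def field_simps)
    have "norm x \<le> norm (fst x) + norm (z *\<^sub>C fst x + k)"
      using norm_Pair_le[of "fst x" "snd x"] by (simp add: k_def)
    also have "\<dots> \<le> norm (fst x) + (cmod z * norm (fst x) + norm k)"
      using norm_triangle_ineq[of "z *\<^sub>C fst x" k] by (simp add: norm_scaleC)
    also have "\<dots> = (1 + cmod z) * norm (fst x) + norm k"
      by (simp add: algebra_simps)
    also have "\<dots> \<le> (1 + cmod z) * (norm k / c) + norm k"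
      using f by (intro add_right_mono mult_left_mono) auto
    also have "\<dots> = C * norm k"
      by (simp add: C_def algebra_simps)
    finally show ?thesis
      using \<open>C > 0\<close> by (simp add: k_def field_simps)
  qed
  have "bounded_linear (\<lambda>x::'h \<times> 'h. snd x - z *\<^sub>C fst x)"
    by (intro bounded_linear_sub bounded_linear_snd
        bounded_linear_compose[OF scaleC.bounded_linear_right] bounded_linear_fst)
  then have "complete (shifted_range z T)"
    unfolding shifted_range_def using \<open>C > 0\<close> bound closed_T
    by (intro complete_isometric_image[of "1 / C"] subspace_of_complex_subspace linear_T)
      (auto simp: complete_eq_closed)
  then show ?thesis
    by (simp add: complete_eq_closed)
qed

text \<open>
  The vectors orthogonal to the range of \<open>T - w\<^sup>*\<close> with respect to \<open>[\<cdot>, \<cdot>]\<close> form \<open>\<NN>\<^sub>w(T\<^sup>+)\<close>. The range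
  is closed, so it equals its double annihilator.
\<close>

lemma orthogonal_eigenspace_iff:
  assumes "w \<notin> \<real>"
  shows "(\<forall>h\<in>eigenspace w adj. ip y h = 0) \<longleftrightarrow> y \<in> shifted_range (cnj w) T"
proof
  assume y: "\<forall>h\<in>eigenspace w adj. ip y h = 0"
  show "y \<in> shifted_range (cnj w) T"
  proof (rule ccontr)
    assume "y \<notin> shifted_range (cnj w) T"
    moreover have "cnj w \<notin> \<real>"
      using assms by (simp add: complex_is_Real_iff)
    ultimately obtain g where g: "\<And>x. x \<in> shifted_range (cnj w) T \<Longrightarrow> cinner x g = 0"
      "cinner y g \<noteq> 0"
      using orthogonal_to_closed_subspace closed_shifted_range subspace_shifted_range linear_T
      by blast
    have "ip f (w *\<^sub>C J g) = ip f' (J g)" if "(f, f') \<in> T" for f f'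
      using g(1)[OF shifted_rangeI[OF that]]
      by (simp add: ip_scaleC_right ip_J cinner.diff_left cinner_scaleC_left)
    then have "J g \<in> eigenspace w adj"
      by (auto simp: eigenspace_def adjoint_rel_def)
    then have "ip y (J g) = 0"
      using y by blast
    then show False
      using g(2) by (simp add: ip_J)
  qed
next
  assume "y \<in> shifted_range (cnj w) T"
  then obtain f f' where f: "(f, f') \<in> T" "y = f' - cnj w *\<^sub>C f"
    by (rule shifted_rangeE)
  show "\<forall>h\<in>eigenspace w adj. ip y h = 0"
  proof
    fix h assume "h \<in> eigenspace w adj"
    then have "ip f (w *\<^sub>C h) = ip f' h"
      using adjD f(1) by (simp add: eigenspace_def)
    then show "ip y h = 0"
      by (simp add: f(2) ip.diff_left ip_scaleC_left ip_scaleC_right)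
  qed
qed

text \<open>
  For each \<open>v \<in> S\<close> near \<open>w\<close> the vector \<open>y\<close> is \<open>f' - v\<^sup>* f\<close> for some \<open>(f, f') \<in> T\<close>, with \<open>f\<close> bounded
  independently of \<open>v\<close>. So \<open>y\<close> is arbitrarily near to elements \<open>f' - w\<^sup>* f\<close> of the closed range of
  \<open>T - w\<^sup>*\<close>.
\<close>

lemma orthogonal_eigenspace_limit:
  assumes "w \<notin> \<real>" and "w islimpt S" and "S \<inter> \<real> = {}"
    and orth: "\<And>v h. v \<in> S \<Longrightarrow> h \<in> eigenspace v adj \<Longrightarrow> ip y h = 0"
    and "h \<in> eigenspace w adj"
  shows "ip y h = 0"
proof -
  have w: "cnj w \<notin> \<real>"
    using assms(1) by (simp add: complex_is_Real_iff)
  obtain c where c: "c > 0" "\<And>f f'. (f, f') \<in> T \<Longrightarrow> c * norm f \<le> norm (f' - cnj w *\<^sub>C f)"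
    using shift_bounded_below[OF w] by blast
  have "\<exists>x\<in>shifted_range (cnj w) T. dist x y < e" if "e > 0" for e
  proof -
    \<comment> \<open>The first term yields \<open>c \<parallel>f\<parallel> \<le> 2 \<parallel>y\<parallel>\<close>, the second one then bounds \<open>|v - w| \<parallel>f\<parallel>\<close> by \<open>e\<close>.\<close>
    define \<delta> where "\<delta> = min (c / 2) (e * c / (2 * norm y + 1))"
    have "\<delta> > 0"
      using \<open>c > 0\<close> \<open>e > 0\<close> by (simp add: \<delta>_def add_nonneg_pos)
    then obtain v where v: "v \<in> S" "dist v w < \<delta>"
      using assms(2) unfolding islimpt_approachable by blast
    then have "y \<in> shifted_range (cnj v) T"
      using orthogonal_eigenspace_iff[of v y] orth assms(3) by blast
    then obtain f f' where f: "(f, f') \<in> T" "y = f' - cnj v *\<^sub>C f"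
      by (rule shifted_rangeE)
    have diff: "f' - cnj w *\<^sub>C f = y + (cnj v - cnj w) *\<^sub>C f"
      by (simp add: f(2) scaleC.diff_left)
    have "cmod (cnj v - cnj w) = dist v w"
      by (simp add: dist_norm flip: complex_cnj_diff)
    note norm_diff = norm_scaleC[of "cnj v - cnj w" f, unfolded this]
    have "c * norm f \<le> norm y + dist v w * norm f"
      using c(2)[OF f(1)] norm_triangle_ineq[of y "(cnj v - cnj w) *\<^sub>C f"]
      unfolding diff norm_diff by linarith
    also have "\<dots> \<le> norm y + c / 2 * norm f"
      using v(2) by (intro add_left_mono mult_right_mono) (auto simp: \<delta>_def)
    finally have f_le: "c * norm f \<le> 2 * norm y"
      by (simp add: field_simps)
    have "dist (f' - cnj w *\<^sub>C f) y * c = dist v w * (c * norm f)"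
      unfolding diff by (simp add: dist_norm norm_diff[unfolded dist_norm])
    also have "\<dots> \<le> dist v w * (2 * norm y)"
      by (intro mult_left_mono f_le) simp
    also have "\<dots> \<le> dist v w * (2 * norm y + 1)"
      by (intro mult_left_mono) auto
    also have "\<dots> < e * c"
      using v(2) by (simp add: \<delta>_def pos_less_divide_eq add_nonneg_pos)
    finally have "dist (f' - cnj w *\<^sub>C f) y < e"
      using \<open>c > 0\<close> by simp
    then show ?thesis
      using shifted_rangeI[OF f(1)] by blast
  qed
  then have "y \<in> closure (shifted_range (cnj w) T)"
    unfolding closure_approachable by blast
  then have "y \<in> shifted_range (cnj w) T"
    using closed_shifted_range[OF w] by simp
  then show ?thesis
    using orthogonal_eigenspace_iff[OF assms(1)] assms(5) by blast
qed

lemma eigenspaces_total: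
  assumes "\<And>w. w \<notin> \<real> \<Longrightarrow> w islimpt S" and "S \<inter> \<real> = {}"
    and "\<And>v h. v \<in> S \<Longrightarrow> h \<in> eigenspace v adj \<Longrightarrow> ip y h = 0"
  shows "y = 0"
proof (rule eq_0_if_ip_eq_0)
  fix x
  show "ip y x = 0"
  proof (rule orthogonal_closure_span)
    fix h assume "h \<in> (\<Union>z \<in> - \<real>. eigenspace z adj)"
    then obtain w where w: "w \<notin> \<real>" "h \<in> eigenspace w adj"
      by blast
    show "ip y h = 0"
      using w(1) assms(1)[OF w(1)] assms(2,3) w(2) by (rule orthogonal_eigenspace_limit)
  next
    show "x \<in> closure (complex_vector.span (\<Union>z \<in> - \<real>. eigenspace z adj))"
      using simple by (simp add: simple_symmetric_def)
  qed
qed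

text \<open>
  This sharpens \<open>T\<^sup>+\<^sup>+ \<subseteq> T\<close>: membership in \<open>T\<^sup>+\<^sup>+\<close> is tested only on the elements \<open>(h, v h)\<close> of
  \<open>T\<^sup>+\<close> with \<open>v \<in> S\<close>. Fix \<open>z \<in> S\<close>. The test on \<open>\<NN>\<^sub>z(T\<^sup>+)\<close> yields
  \<open>(t, t') \<in> T\<close> such that \<open>(k, z\<^sup>* k) = (t - u, t' - u')\<close> for some \<open>k\<close>. This difference passes
  the same tests, which for \<open>v \<noteq> z\<close> say that \<open>k\<close> is orthogonal to \<open>\<NN>\<^sub>v(T\<^sup>+)\<close>. These
  spaces are total, hence \<open>k = 0\<close>.
\<close>

lemma in_T_if_annihilates_eigenspaces:
  assumes S: "\<And>w. w \<notin> \<real> \<Longrightarrow> w islimpt S" "S \<inter> \<real> = {}"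
    and test: "\<And>v h. v \<in> S \<Longrightarrow> h \<in> eigenspace v adj \<Longrightarrow> ip u (v *\<^sub>C h) = ip u' h"
  shows "(u, u') \<in> T"
proof -
  have "\<i> islimpt S"
    by (intro S(1)) (simp add: complex_is_Real_iff)
  then obtain z where z: "z \<in> S"
    unfolding islimpt_approachable using zero_less_one by blast
  then have "z \<notin> \<real>"
    using S(2) by blast
  have "ip (u' - cnj z *\<^sub>C u) h = 0" if "h \<in> eigenspace z adj" for h
    using test[OF z that] by (simp add: ip.diff_left ip_scaleC_left ip_scaleC_right)
  then have "u' - cnj z *\<^sub>C u \<in> shifted_range (cnj z) T"
    using orthogonal_eigenspace_iff[OF \<open>z \<notin> \<real>\<close>] by blast
  then obtain t t' where t: "(t, t') \<in> T" "u' - cnj z *\<^sub>C u = t' - cnj z *\<^sub>C t"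
    by (rule shifted_rangeE)
  define k where "k = t - u"
  have k: "t' - u' = cnj z *\<^sub>C k"
    using t(2) by (simp add: k_def scaleC.diff_right algebra_simps)
  have "k = 0"
  proof (rule eigenspaces_total)
    show "w islimpt S - {z}" if "w \<notin> \<real>" for w
      using S(1)[OF that] islimpt_insert[of w z "S - {z}"] z by (simp add: insert_absorb)
    show "(S - {z}) \<inter> \<real> = {}"
      using S(2) by blast
    fix v h assume v: "v \<in> S - {z}" and h: "h \<in> eigenspace v adj"
    have "ip t (v *\<^sub>C h) = ip t' h"
      using h t(1) adjD by (simp add: eigenspace_def)
    then have "ip k (v *\<^sub>C h) = ip (t' - u') h"
      using test[of v h] v h by (simp add: k_def ip.diff_left)
    then have "ip k (v *\<^sub>C h) = ip (cnj z *\<^sub>C k) h"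
      unfolding k .
    then have "(v - z) * ip k h = 0"
      by (simp add: ip_scaleC_left ip_scaleC_right algebra_simps)
    then show "ip k h = 0"
      using v by simp
  qed
  then show ?thesis
    using t(1) k by (simp add: k_def scaleC.zero_right)
qed

end

section \<open>Boundary triples\<close>

lemma linear_relation_Image:
  assumes "linear_relation R" and "complex_vector.subspace L"
  shows "complex_vector.subspace (R `` L)"
proof (rule complex_vector.subspaceI)
  show "0 \<in> R `` L"
    using complex_vector.subspace_0[OF assms(1)] complex_vector.subspace_0[OF assms(2)]
    by (auto simp: zero_prod_def)
  show "y + y' \<in> R `` L" if "y \<in> R `` L" "y' \<in> R `` L" for y y'
  proof -
    obtain x x' where "(x, y) \<in> R" "x \<in> L" "(x', y') \<in> R" "x' \<in> L"
      using \<open>y \<in> R `` L\<close> \<open>y' \<in> R `` L\<close> by blast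
    then show ?thesis
      using complex_vector.subspace_add[OF assms(1), of "(x, y)" "(x', y')"]
        complex_vector.subspace_add[OF assms(2), of x x'] by auto
  qed
  show "c *\<^sub>C y \<in> R `` L" if "y \<in> R `` L" for c y
  proof -
    obtain x where "(x, y) \<in> R" "x \<in> L"
      using \<open>y \<in> R `` L\<close> by blast
    then show ?thesis
      using complex_vector.subspace_scale[OF assms(1), of "(x, y)" c]
        complex_vector.subspace_scale[OF assms(2), of x c] by (auto simp: scaleC_prod_def)
  qed
qed

locale boundary_triple_relation = simple_symmetric_relation J ip T
  for J :: "'h::complex_hilbert \<Rightarrow> 'h" and ip T +
  fixes \<Gamma>0 \<Gamma>1 :: "'h \<times> 'h \<Rightarrow> 'l::complex_hilbert"
  assumes triple: "boundary_triple ip T \<Gamma>0 \<Gamma>1"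
begin

abbreviation \<Gamma> :: "(('h \<times> 'h) \<times> ('l \<times> 'l)) set" where
  "\<Gamma> \<equiv> boundary_map ip T \<Gamma>0 \<Gamma>1"

lemma linear_\<Gamma>: "linear_relation \<Gamma>"
  using triple unfolding boundary_triple_def by simp

lemma \<Gamma>_iff: "(x, l) \<in> \<Gamma> \<longleftrightarrow> x \<in> adj \<and> l = (\<Gamma>0 x, \<Gamma>1 x)"
  unfolding boundary_map_def op_graph_def by (cases x) auto

lemma green:
  assumes "(f, f') \<in> adj" and "(g, g') \<in> adj"
  shows "ip f g' - ip f' g
    = cinner (\<Gamma>0 (f, f')) (\<Gamma>1 (g, g')) - cinner (\<Gamma>1 (f, f')) (\<Gamma>0 (g, g'))"
proof -
  have "\<forall>(f, f')\<in>adj. \<forall>(g, g')\<in>adj. ip f g' - ip f' g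
      = cinner (\<Gamma>0 (f, f')) (\<Gamma>1 (g, g')) - cinner (\<Gamma>1 (f, f')) (\<Gamma>0 (g, g'))"
    using triple unfolding boundary_triple_def by simp
  from bspec[OF this assms(1)] show ?thesis
    using assms(2) by auto
qed

lemma boundary_values_attained: "\<exists>x\<in>adj. \<Gamma>0 x = a \<and> \<Gamma>1 x = b"
proof -
  have "(a, b) \<in> Range \<Gamma>"
    using triple unfolding boundary_triple_def by simp
  then show ?thesis
    by (auto simp: \<Gamma>_iff)
qed

lemma \<Gamma>_add:
  assumes "x \<in> adj" and "y \<in> adj"
  shows "x + y \<in> adj" and "\<Gamma>0 (x + y) = \<Gamma>0 x + \<Gamma>0 y" and "\<Gamma>1 (x + y) = \<Gamma>1 x + \<Gamma>1 y"
proof -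
  have "(x, (\<Gamma>0 x, \<Gamma>1 x)) + (y, (\<Gamma>0 y, \<Gamma>1 y)) \<in> \<Gamma>"
    using assms by (intro complex_vector.subspace_add[OF linear_\<Gamma>]) (simp_all add: \<Gamma>_iff)
  then show "x + y \<in> adj" "\<Gamma>0 (x + y) = \<Gamma>0 x + \<Gamma>0 y" "\<Gamma>1 (x + y) = \<Gamma>1 x + \<Gamma>1 y"
    by (simp_all add: \<Gamma>_iff)
qed

text \<open>By Green's identity the boundary values of an element of \<open>T\<close> are orthogonal, up to a sign and a
  swap, to all boundary values, and these exhaust the boundary space.\<close>

lemma \<Gamma>_eq_0:
  assumes "x \<in> T"
  shows "\<Gamma>0 x = 0" and "\<Gamma>1 x = 0"
proof -
  obtain f f' where x: "x = (f, f')"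
    by fastforce
  obtain y where y: "y \<in> adj" "\<Gamma>0 y = - \<Gamma>1 x" "\<Gamma>1 y = \<Gamma>0 x"
    using boundary_values_attained[of "- \<Gamma>1 x" "\<Gamma>0 x"] by blast
  obtain g g' where yg: "y = (g, g')"
    by fastforce
  have "ip f g' = ip f' g"
    using adjD[of g g' f f'] y(1) assms x yg by simp
  then have "0 = cinner (\<Gamma>0 x) (\<Gamma>0 x) + cinner (\<Gamma>1 x) (\<Gamma>1 x)"
    using green[of f f' g g'] y assms T_subset_adj x yg by (auto simp: cinner.minus_right)
  then have "complex_of_real ((norm (\<Gamma>0 x))\<^sup>2 + (norm (\<Gamma>1 x))\<^sup>2) = 0"
    by (simp add: cinner_self)
  then have "(norm (\<Gamma>0 x))\<^sup>2 + (norm (\<Gamma>1 x))\<^sup>2 = 0"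
    using of_real_eq_0_iff by blast
  then show "\<Gamma>0 x = 0" "\<Gamma>1 x = 0"
    by (simp_all add: sum_power2_eq_zero_iff)
qed

lemma canonical_extension_boundary_condition:
  assumes "linear_relation \<Theta>"
  shows "canonical_extension ip T (\<Gamma>\<inverse> `` \<Theta>)"
  unfolding canonical_extension_def
proof (intro conjI)
  show "linear_relation (\<Gamma>\<inverse> `` \<Theta>)"
    using linear_\<Gamma> assms by (intro linear_relation_Image linear_relation_converse)
  have "(0, 0) \<in> \<Theta>"
    using complex_vector.subspace_0[OF assms] by (simp add: zero_prod_def)
  then show "T \<subseteq> \<Gamma>\<inverse> `` \<Theta>"
    using T_subset_adj \<Gamma>_eq_0 by (force simp: \<Gamma>_iff)
  show "\<Gamma>\<inverse> `` \<Theta> \<subseteq> adj"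
    by (auto simp: \<Gamma>_iff)
qed

lemma weyl_family_iff:
  "(a, b) \<in> weyl_family ip T \<Gamma>0 \<Gamma>1 z
    \<longleftrightarrow> (\<exists>h\<in>eigenspace z adj. \<Gamma>0 (h, z *\<^sub>C h) = a \<and> \<Gamma>1 (h, z *\<^sub>C h) = b)"
  unfolding weyl_family_def scalar_rel_def op_graph_def eigenspace_def by (auto simp: \<Gamma>_iff)

end

section \<open>Boundary triples with the same Weyl family\<close>

text \<open>
  For eigenvectors to eigenvalues \<open>z\<close> and \<open>w\<close>, Green's identity reads
  \<open>(w - z\<^sup>*) [f, g] = \<langle>\<Gamma>\<^sub>0, \<Gamma>\<^sub>1\<rangle> - \<langle>\<Gamma>\<^sub>1, \<Gamma>\<^sub>0\<rangle>\<close> and determines \<open>[f, g]\<close> from the boundary values unless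
  \<open>w = z\<^sup>*\<close>. A dense set of non-real numbers without conjugate pairs
  avoids the exception: take rational real parts in the upper half plane, irrational ones below.
\<close>

lemma dense_set_without_conjugate_pairs:
  obtains S :: "complex set" where "S \<inter> \<real> = {}" and "\<And>w. w \<notin> \<real> \<Longrightarrow> w islimpt S"
    and "\<And>z. z \<in> S \<Longrightarrow> cnj z \<notin> S"
proof
  let ?S = "{z. Im z \<noteq> 0 \<and> (Im z > 0 \<longleftrightarrow> Re z \<in> \<rat>)}"
  show "?S \<inter> \<real> = {}"
    by (auto simp: complex_is_Real_iff)
  show "cnj z \<notin> ?S" if "z \<in> ?S" for z
    using that by (cases "Im z > 0") auto
  show "w islimpt ?S" if "w \<notin> \<real>" for w
    unfolding islimpt_approachable
  proof (intro allI impI)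
    fix e :: real assume "e > 0"
    have "\<exists>r. Re w < r \<and> r < Re w + e \<and> (Im w > 0 \<longleftrightarrow> r \<in> \<rat>)"
    proof (cases "Im w > 0")
      case True
      then show ?thesis
        using Rats_dense_in_real[of "Re w" "Re w + e"] \<open>e > 0\<close> by auto
    next
      case False
      have "uncountable ({Re w<..<Re w + e} - \<rat>)"
        using \<open>e > 0\<close> countable_rat
        by (intro uncountable_minus_countable uncountable_open_interval[THEN iffD2]) auto
      then obtain r where "r \<in> {Re w<..<Re w + e} - \<rat>"
        by (metis countable_empty equals0I)
      then show ?thesis
        using False by auto
    qed
    then obtain r where r: "Re w < r" "r < Re w + e" "Im w > 0 \<longleftrightarrow> r \<in> \<rat>"
      by blast
    have "Complex r (Im w) \<in> ?S"
      using that r(3) by (simp add: complex_is_Real_iff)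
    moreover have "Complex r (Im w) \<noteq> w"
      using r(1) by (auto simp: complex_eq_iff)
    moreover have "dist (Complex r (Im w)) w < e"
      using r(1,2) by (simp add: dist_norm cmod_def)
    ultimately show "\<exists>x'\<in>?S. x' \<noteq> w \<and> dist x' w < e"
      by blast
  qed
qed

locale boundary_triple_pair =
  H: boundary_triple_relation J ip T \<Gamma>0 \<Gamma>1 + K: boundary_triple_relation J' ip' T' \<Gamma>0' \<Gamma>1'
  for J :: "'h::complex_hilbert \<Rightarrow> 'h" and ip T and \<Gamma>0 \<Gamma>1 :: "'h \<times> 'h \<Rightarrow> 'l::complex_hilbert"
    and J' :: "'k::complex_hilbert \<Rightarrow> 'k" and ip' T' and \<Gamma>0' \<Gamma>1' :: "'k \<times> 'k \<Rightarrow> 'l"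
begin

text \<open>
  For non-real \<open>z\<close> the boundary maps are injective on eigenvectors of \<open>T\<^sup>+\<close>; their inverse is the
  \<open>\<gamma>\<close>-field \<open>\<gamma>(z)\<close>. The following relation is the graph of \<open>\<gamma>'(z) \<gamma>(z)\<^sup>-\<^sup>1\<close>.
\<close>

definition matching :: "complex \<Rightarrow> ('h \<times> 'k) set" where
  "matching z = {(f, g). f \<in> eigenspace z H.adj \<and> g \<in> eigenspace z K.adj
    \<and> \<Gamma>0' (g, z *\<^sub>C g) = \<Gamma>0 (f, z *\<^sub>C f) \<and> \<Gamma>1' (g, z *\<^sub>C g) = \<Gamma>1 (f, z *\<^sub>C f)}"

lemma matchingD:
  assumes "(f, g) \<in> matching z"
  shows "(f, z *\<^sub>C f) \<in> H.adj" and "(g, z *\<^sub>C g) \<in> K.adj"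
    and "\<Gamma>0' (g, z *\<^sub>C g) = \<Gamma>0 (f, z *\<^sub>C f)" and "\<Gamma>1' (g, z *\<^sub>C g) = \<Gamma>1 (f, z *\<^sub>C f)"
  using assms by (auto simp: matching_def eigenspace_def)

lemma Domain_matching:
  assumes "weyl_family ip T \<Gamma>0 \<Gamma>1 z \<subseteq> weyl_family ip' T' \<Gamma>0' \<Gamma>1' z"
  shows "Domain (matching z) = eigenspace z H.adj"
proof
  show "Domain (matching z) \<subseteq> eigenspace z H.adj"
    by (auto simp: matching_def)
  show "eigenspace z H.adj \<subseteq> Domain (matching z)"
  proof
    fix f assume f: "f \<in> eigenspace z H.adj"
    then have "(\<Gamma>0 (f, z *\<^sub>C f), \<Gamma>1 (f, z *\<^sub>C f)) \<in> weyl_family ip T \<Gamma>0 \<Gamma>1 z"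
      unfolding H.weyl_family_iff by blast
    with assms have "(\<Gamma>0 (f, z *\<^sub>C f), \<Gamma>1 (f, z *\<^sub>C f)) \<in> weyl_family ip' T' \<Gamma>0' \<Gamma>1' z"
      by (rule subsetD)
    then show "f \<in> Domain (matching z)"
      using f unfolding K.weyl_family_iff by (auto simp: matching_def)
  qed
qed

lemma Range_matching:
  assumes "weyl_family ip' T' \<Gamma>0' \<Gamma>1' z \<subseteq> weyl_family ip T \<Gamma>0 \<Gamma>1 z"
  shows "Range (matching z) = eigenspace z K.adj"
proof
  show "Range (matching z) \<subseteq> eigenspace z K.adj"
    by (auto simp: matching_def)
  show "eigenspace z K.adj \<subseteq> Range (matching z)"
  proof
    fix g assume g: "g \<in> eigenspace z K.adj"
    then have "(\<Gamma>0' (g, z *\<^sub>C g), \<Gamma>1' (g, z *\<^sub>C g)) \<in> weyl_family ip' T' \<Gamma>0' \<Gamma>1' z"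
      unfolding K.weyl_family_iff by blast
    with assms have "(\<Gamma>0' (g, z *\<^sub>C g), \<Gamma>1' (g, z *\<^sub>C g)) \<in> weyl_family ip T \<Gamma>0 \<Gamma>1 z"
      by (rule subsetD)
    then obtain f where "f \<in> eigenspace z H.adj" "\<Gamma>0 (f, z *\<^sub>C f) = \<Gamma>0' (g, z *\<^sub>C g)"
      "\<Gamma>1 (f, z *\<^sub>C f) = \<Gamma>1' (g, z *\<^sub>C g)"
      unfolding H.weyl_family_iff by blast
    then have "(f, g) \<in> matching z"
      using g by (simp add: matching_def)
    then show "g \<in> Range (matching z)"
      by blast
  qed
qed

lemma matching_isometric:
  assumes "(f, g) \<in> matching z" and "(a, b) \<in> matching w" and "w \<noteq> cnj z"
  shows "ip' g b = ip f a"
proof -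
  note fg = matchingD[OF assms(1)] and ab = matchingD[OF assms(2)]
  have "ip' g (w *\<^sub>C b) - ip' (z *\<^sub>C g) b = ip f (w *\<^sub>C a) - ip (z *\<^sub>C f) a"
    by (simp only: H.green[OF fg(1) ab(1)] K.green[OF fg(2) ab(2)] fg(3,4) ab(3,4))
  then have "(w - cnj z) * ip' g b = (w - cnj z) * ip f a"
    by (simp add: H.ip_scaleC_left H.ip_scaleC_right K.ip_scaleC_left K.ip_scaleC_right
        algebra_simps)
  then show ?thesis
    using assms(3) by simp
qed

text \<open>\<open>S\<close> contains no conjugate pairs, so the exceptional case of the preceding lemma does not occur
  and the isometry passes to linear combinations.\<close>

lemma span_matching_isometric:
  assumes S: "\<And>z. z \<in> S \<Longrightarrow> cnj z \<notin> S"
    and "x \<in> complex_vector.span (\<Union>z\<in>S. matching z)" and "y \<in> complex_vector.span (\<Union>z\<in>S. matching z)"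
  shows "ip' (snd x) (snd y) = ip (fst x) (fst y)"
proof -
  let ?M = "\<Union>z\<in>S. matching z"
  have 1: "ip' (snd x) (snd y) = ip (fst x) (fst y)" 
    if x: "x \<in> ?M" and "y \<in> complex_vector.span ?M" for x y
    using that(2)
  proof (rule complex_vector.span_induct)
    show "complex_vector.subspace {y. ip' (snd x) (snd y) = ip (fst x) (fst y)}"
      by (rule complex_vector.subspaceI)
        (simp_all add: H.ip.zero_right K.ip.zero_right H.ip_add_right K.ip_add_right
          scaleC_prod_def H.ip_scaleC_right K.ip_scaleC_right)
    fix y assume "y \<in> ?M"
    then obtain z w where "z \<in> S" "w \<in> S" and xy: "x \<in> matching z" "y \<in> matching w"
      using x by blast
    then have "w \<noteq> cnj z"
      using S by blast
    with xy show "ip' (snd x) (snd y) = ip (fst x) (fst y)"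
      using matching_isometric[of "fst x" "snd x" z "fst y" "snd y" w] by simp
  qed
  show ?thesis
    using assms(2)
  proof (rule complex_vector.span_induct)
    show "complex_vector.subspace {x. ip' (snd x) (snd y) = ip (fst x) (fst y)}"
      by (rule complex_vector.subspaceI)
        (simp_all add: H.ip.zero_left K.ip.zero_left H.ip_add_left K.ip_add_left
          scaleC_prod_def H.ip_scaleC_left K.ip_scaleC_left)
  qed (use 1 assms(3) in blast)
qed

lemma matching_extends_to_standard_unitary:
  assumes S: "S \<inter> \<real> = {}" "\<And>w. w \<notin> \<real> \<Longrightarrow> w islimpt S" "\<And>z. z \<in> S \<Longrightarrow> cnj z \<notin> S"
    and weyl: "\<And>z. z \<in> S \<Longrightarrow> weyl_family ip T \<Gamma>0 \<Gamma>1 z = weyl_family ip' T' \<Gamma>0' \<Gamma>1' z"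
  obtains U where "standard_unitary ip ip' U" and "\<And>z f g. z \<in> S \<Longrightarrow> (f, g) \<in> matching z \<Longrightarrow> U f = g"
proof -
  let ?M = "\<Union>z\<in>S. matching z"
  let ?G = "complex_vector.span ?M"
  have lin: "linear_relation ?G"
    by (rule complex_vector.subspace_span)
  have sub: "?M \<subseteq> ?G"
    by (rule complex_vector.span_superset)
  have "closure (complex_vector.span (Domain ?M)) = UNIV"
  proof (rule H.span_dense_if_total)
    fix k assume k: "\<And>y. y \<in> Domain ?M \<Longrightarrow> ip k y = 0"
    show "k = 0"
    proof (rule H.eigenspaces_total[OF S(2,1)])
      fix v h assume "v \<in> S" "h \<in> eigenspace v H.adj"
      then have "h \<in> Domain ?M"
        using Domain_matching[OF eq_refl[OF weyl[OF \<open>v \<in> S\<close>]]] by blast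
      then show "ip k h = 0"
        by (rule k)
    qed
  qed
  moreover have "complex_vector.span (Domain ?M) \<subseteq> Domain ?G"
  proof (rule complex_vector.span_minimal)
    have "Domain ?G = ?G\<inverse> `` UNIV"
      by blast
    then show "complex_vector.subspace (Domain ?G)"
      using linear_relation_Image[OF linear_relation_converse[OF lin] complex_vector.subspace_UNIV]
      by (simp only:)
  qed (use sub in blast)
  ultimately have dom: "closure (Domain ?G) = UNIV"
    using closure_mono by blast
  have "closure (complex_vector.span (Range ?M)) = UNIV"
  proof (rule K.span_dense_if_total)
    fix k assume k: "\<And>y. y \<in> Range ?M \<Longrightarrow> ip' k y = 0"
    show "k = 0"
    proof (rule K.eigenspaces_total[OF S(2,1)])
      fix v h assume "v \<in> S" "h \<in> eigenspace v K.adj"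
      then have "h \<in> Range ?M"
        using Range_matching[OF eq_refl[OF weyl[OF \<open>v \<in> S\<close>, symmetric]]] by blast
      then show "ip' k h = 0"
        by (rule k)
    qed
  qed
  moreover have "complex_vector.span (Range ?M) \<subseteq> Range ?G"
  proof (rule complex_vector.span_minimal)
    have "Range ?G = ?G `` UNIV"
      by blast
    then show "complex_vector.subspace (Range ?G)"
      using linear_relation_Image[OF lin complex_vector.subspace_UNIV] by (simp only:)
  qed (use sub in blast)
  ultimately have ran: "closure (Range ?G) = UNIV"
    using closure_mono by blast
  have iso: "ip' g b = ip f a" if "(f, g) \<in> ?G" "(a, b) \<in> ?G" for f g a b
    using span_matching_isometric[OF S(3) that] by simp
  obtain U where U: "standard_unitary ip ip' U" "\<forall>(f, g)\<in>?G. U f = g"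
    using isometric_relation_extends_to_standard_unitary[OF H.pontryagin_space_axioms
        K.pontryagin_space_axioms lin iso dom ran] by blast
  show thesis
  proof (rule that)
    show "standard_unitary ip ip' U"
      by (rule U(1))
    show "U f = g" if "z \<in> S" "(f, g) \<in> matching z" for z f g
    proof -
      have "(f, g) \<in> ?G"
        using that sub by blast
      then show ?thesis
        using bspec[OF U(2)] by fastforce
    qed
  qed
qed

text \<open>
  Elements of \<open>T\<close> are recognized by pairing them with the eigenvectors of \<open>T\<^sup>+\<close>, so \<open>U\<close> carries
  \<open>T\<close> to \<open>T'\<close> and hence \<open>T\<^sup>+\<close> to \<open>T'\<^sup>+\<close>. For \<open>x \<in> T\<^sup>+\<close> choose \<open>y \<in> T'\<^sup>+\<close> with the boundary
  values of \<open>x\<close>. By Green's identity, \<open>U x\<close> and \<open>y\<close> pair in the same way with all eigenvectors,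
  so they differ by an element of \<open>T'\<close>, on which the boundary maps vanish.
\<close>

lemma matching_unitary_intertwines:
  assumes S: "S \<inter> \<real> = {}" "\<And>w. w \<notin> \<real> \<Longrightarrow> w islimpt S"
    and weyl: "\<And>z. z \<in> S \<Longrightarrow> weyl_family ip T \<Gamma>0 \<Gamma>1 z = weyl_family ip' T' \<Gamma>0' \<Gamma>1' z"
    and U: "standard_unitary ip ip' U"
    and match: "\<And>z f g. z \<in> S \<Longrightarrow> (f, g) \<in> matching z \<Longrightarrow> U f = g"
  shows "K.\<Gamma> = (op_graph UNIV (map_prod U U))\<inverse> O H.\<Gamma>"
proof -
  have U_ip: "ip' (U f) (U g) = ip f g" and U_scale: "U (c *\<^sub>C f) = c *\<^sub>C U f" for f g c
    using U by (simp_all add: standard_unitary_def)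
  have "bij U"
    using U by (simp add: standard_unitary_def)
  have matched: "(h, U h) \<in> matching v" if v: "v \<in> S" and h: "h \<in> eigenspace v H.adj" for v h
  proof -
    obtain g where g: "(h, g) \<in> matching v"
      using Domain_matching[OF eq_refl[OF weyl[OF v]]] h by blast
    then show ?thesis
      using match[OF v g] by simp
  qed
  have eigenvector_image: "\<exists>h\<in>eigenspace v H.adj. g = U h"
    if v: "v \<in> S" and g: "g \<in> eigenspace v K.adj" for v g
  proof -
    obtain h where h: "(h, g) \<in> matching v"
      using Range_matching[OF eq_refl[OF weyl[OF v, symmetric]]] g by blast
    then have "h \<in> eigenspace v H.adj"
      by (simp add: matching_def)
    then show ?thesis
      using match[OF v h] by blast
  qed
  have T_iff: "(U u, U u') \<in> T' \<longleftrightarrow> (u, u') \<in> T" for u u'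
  proof
    assume u: "(U u, U u') \<in> T'"
    show "(u, u') \<in> T"
    proof (rule H.in_T_if_annihilates_eigenspaces[OF S(2,1)])
      fix v h assume vh: "v \<in> S" "h \<in> eigenspace v H.adj"
      have "(U h, v *\<^sub>C U h) \<in> K.adj"
        by (rule matchingD(2)[OF matched[OF vh]])
      then have "ip' (U u) (v *\<^sub>C U h) = ip' (U u') (U h)"
        using u by (rule K.adjD)
      then show "ip u (v *\<^sub>C h) = ip u' h"
        by (simp only: U_scale[symmetric] U_ip)
    qed
  next
    assume u: "(u, u') \<in> T"
    show "(U u, U u') \<in> T'"
    proof (rule K.in_T_if_annihilates_eigenspaces[OF S(2,1)])
      fix v g assume "v \<in> S" "g \<in> eigenspace v K.adj"
      then obtain h where h: "h \<in> eigenspace v H.adj" "g = U h"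
        using eigenvector_image by blast
      have "ip u (v *\<^sub>C h) = ip u' h"
        using h(1) u H.adjD by (simp add: eigenspace_def)
      then show "ip' (U u) (v *\<^sub>C g) = ip' (U u') g"
        by (simp only: h(2) U_scale[symmetric] U_ip)
    qed
  qed
  have adj_iff: "(U f, U f') \<in> K.adj \<longleftrightarrow> (f, f') \<in> H.adj" for f f'
  proof -
    have "(U f, U f') \<in> K.adj \<longleftrightarrow> (\<forall>t t'. (t, t') \<in> T' \<longrightarrow> ip' t (U f') = ip' t' (U f))"
      by (auto simp: adjoint_rel_def)
    also have "\<dots> \<longleftrightarrow> (\<forall>t t'. (U t, U t') \<in> T' \<longrightarrow> ip' (U t) (U f') = ip' (U t') (U f))"
      using \<open>bij U\<close> by (metis bij_pointE)
    also have "\<dots> \<longleftrightarrow> (f, f') \<in> H.adj"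
      by (auto simp: T_iff U_ip adjoint_rel_def)
    finally show ?thesis .
  qed
  have same_values: "\<Gamma>0' (U f, U f') = \<Gamma>0 (f, f') \<and> \<Gamma>1' (U f, U f') = \<Gamma>1 (f, f')"
    if f: "(f, f') \<in> H.adj" for f f'
  proof -
    obtain y where y: "y \<in> K.adj" "\<Gamma>0' y = \<Gamma>0 (f, f')" "\<Gamma>1' y = \<Gamma>1 (f, f')"
      using K.boundary_values_attained by metis
    obtain g g' where yg: "y = (g, g')"
      by fastforce
    have d: "(U f - g, U f' - g') \<in> T'"
    proof (rule K.in_T_if_annihilates_eigenspaces[OF S(2,1)])
      fix v k assume v: "v \<in> S" and "k \<in> eigenspace v K.adj"
      then obtain h where h: "h \<in> eigenspace v H.adj" "k = U h"
        using eigenvector_image by blast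
      note m = matchingD[OF matched[OF v h(1)]]
      have "ip' g (v *\<^sub>C U h) - ip' g' (U h) = ip f (v *\<^sub>C h) - ip f' h"
        using H.green[OF f m(1)] K.green[OF _ m(2), of g g'] y yg m(3,4) by simp
      also have "\<dots> = ip' (U f) (v *\<^sub>C U h) - ip' (U f') (U h)"
        by (simp only: U_scale[symmetric] U_ip)
      finally show "ip' (U f - g) (v *\<^sub>C k) = ip' (U f' - g') k"
        by (simp add: h(2) K.ip.diff_left algebra_simps)
    qed
    have "(U f, U f') = y + (U f - g, U f' - g')"
      by (simp add: yg)
    then show ?thesis
      using K.\<Gamma>_add(2,3)[OF y(1) subsetD[OF K.T_subset_adj d]] K.\<Gamma>_eq_0[OF d] y(2,3) by simp
  qed
  have "(x', l) \<in> K.\<Gamma> \<longleftrightarrow> (x', l) \<in> (op_graph UNIV (map_prod U U))\<inverse> O H.\<Gamma>" for x' l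
  proof -
    obtain f f' where x': "x' = (U f, U f')"
      using \<open>bij U\<close> by (metis bij_pointE surj_pair)
    have "(x, x') \<in> op_graph UNIV (map_prod U U) \<longleftrightarrow> x = (f, f')" for x
      using \<open>bij U\<close> by (cases x) (auto simp: op_graph_def x' bij_def inj_eq)
    then have "(x', l) \<in> (op_graph UNIV (map_prod U U))\<inverse> O H.\<Gamma> \<longleftrightarrow> ((f, f'), l) \<in> H.\<Gamma>"
      by auto
    also have "\<dots> \<longleftrightarrow> (x', l) \<in> K.\<Gamma>"
      using adj_iff[of f f'] same_values[of f f'] by (auto simp: H.\<Gamma>_iff K.\<Gamma>_iff x')
    finally show ?thesis
      by simp
  qed
  then show ?thesis
    by (intro set_eqI) (auto simp only: split_paired_all)
qed

end

lemma similar_boundary_condition: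
  assumes "R' = (op_graph UNIV (map_prod U U))\<inverse> O R"
  shows "R'\<inverse> `` \<Theta> = (op_graph UNIV U)\<inverse> O (R\<inverse> `` \<Theta>) O op_graph UNIV U"
  unfolding assms op_graph_def by (force simp: relcomp_unfold)

theorem theorem1p4:
  fixes J :: "'h::complex_hilbert \<Rightarrow> 'h" and ip :: "'h \<Rightarrow> 'h \<Rightarrow> complex"
    and J' :: "'k::complex_hilbert \<Rightarrow> 'k" and ip' :: "'k \<Rightarrow> 'k \<Rightarrow> complex"
    and T :: "('h \<times> 'h) set" and T' :: "('k \<times> 'k) set"
    and \<Gamma>0 \<Gamma>1 :: "'h \<times> 'h \<Rightarrow> 'l::complex_hilbert" and \<Gamma>0' \<Gamma>1' :: "'k \<times> 'k \<Rightarrow> 'l"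
    and d :: enat
  assumes "pontryagin_space J ip" and "pontryagin_space J' ip'"
    and "simple_symmetric ip T" and "densely_defined T"
    and "simple_symmetric ip' T'" and "densely_defined T'"
    and "equal_defect_numbers J ip T d" and "equal_defect_numbers J' ip' T' d"
    and "boundary_triple ip T \<Gamma>0 \<Gamma>1" and "boundary_triple ip' T' \<Gamma>0' \<Gamma>1'"
    and "\<And>z. z \<notin> \<real> \<Longrightarrow> weyl_family ip T \<Gamma>0 \<Gamma>1 z = weyl_family ip' T' \<Gamma>0' \<Gamma>1' z"
  defines "\<Gamma> \<equiv> boundary_map ip T \<Gamma>0 \<Gamma>1" and "\<Gamma>' \<equiv> boundary_map ip' T' \<Gamma>0' \<Gamma>1'"
  shows "\<exists>U. similar_via ip ip' U \<Gamma> \<Gamma>' \<and>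
    (\<forall>\<Theta>. linear_relation \<Theta> \<longrightarrow>
       canonical_extension ip T (\<Gamma>\<inverse> `` \<Theta>) \<and>
       canonical_extension ip' T' (\<Gamma>'\<inverse> `` \<Theta>) \<and>
       \<Gamma>'\<inverse> `` \<Theta> = (op_graph UNIV U)\<inverse> O (\<Gamma>\<inverse> `` \<Theta>) O op_graph UNIV U)"
proof -
  interpret H: pontryagin_space J ip by fact
  interpret K: pontryagin_space J' ip' by fact
  interpret boundary_triple_pair J ip T \<Gamma>0 \<Gamma>1 J' ip' T' \<Gamma>0' \<Gamma>1'
    by unfold_locales fact+
  obtain S where S: "S \<inter> \<real> = {}" "\<And>w. w \<notin> \<real> \<Longrightarrow> w islimpt S" "\<And>z. z \<in> S \<Longrightarrow> cnj z \<notin> S"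
    using dense_set_without_conjugate_pairs by metis
  have weyl: "weyl_family ip T \<Gamma>0 \<Gamma>1 z = weyl_family ip' T' \<Gamma>0' \<Gamma>1' z" if "z \<in> S" for z
    using S(1) that by (intro assms(11)) blast
  obtain U where U: "standard_unitary ip ip' U"
    and match: "\<And>z f g. z \<in> S \<Longrightarrow> (f, g) \<in> matching z \<Longrightarrow> U f = g"
    using matching_extends_to_standard_unitary[OF S weyl] by metis
  have *: "\<Gamma>' = (op_graph UNIV (map_prod U U))\<inverse> O \<Gamma>"
    unfolding \<Gamma>_def \<Gamma>'_def by (rule matching_unitary_intertwines[OF S(1,2) weyl U match])
  show ?thesis
  proof (intro exI[of _ U] conjI allI impI)
    show "similar_via ip ip' U \<Gamma> \<Gamma>'"
      unfolding similar_via_def using U * by blast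
    fix \<Theta> :: "('l \<times> 'l) set" assume \<Theta>: "linear_relation \<Theta>"
    show "canonical_extension ip T (\<Gamma>\<inverse> `` \<Theta>)"
      unfolding \<Gamma>_def using \<Theta> by (rule H.canonical_extension_boundary_condition)
    show "canonical_extension ip' T' (\<Gamma>'\<inverse> `` \<Theta>)"
      unfolding \<Gamma>'_def using \<Theta> by (rule K.canonical_extension_boundary_condition)
    show "\<Gamma>'\<inverse> `` \<Theta> = (op_graph UNIV U)\<inverse> O (\<Gamma>\<inverse> `` \<Theta>) O op_graph UNIV U"
      using * by (rule similar_boundary_condition)
  qed
qed

end
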